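(* Let $0<q<1$. For every $s\in\mathbb{C}$ with $\Re(s)>1$ and $s\notin 2+\frac{2\pi i}{\log q}\mathbb{Z}$, we have \[ \sum_{n=0}^\infty\left(\zeta_q(s-n-2,\,n+2)-\zeta_q(-n,\,s+n)\right)=\zeta_q(s). \]
   Context: Fix $0<q<1$ and for a positive integer $m$ put $[m]_q=\frac{1-q^m}{1-q}$. The $q$-analogue of the Euler--Zagier multiple zeta function is \[ \zeta_q(s_1,\ldots,s_r)=\sum_{0<n_1<\cdots<n_r}\prod_{j=1}^r\frac{q^{(s_j-1)n_j}}{[n_j]_q^{s_j}},\qquad s_j\in\mathbb{C}, \] which converges absolutely on $\{\Re(s_{r-k+1}+\cdots+s_r)>k,\ k=1,\ldots,r\}$ and is understood elsewhere via its meromorphic continuation to $\mathbb{C}^r$ (whose singularities lie on the set where $s_r\in 1+\frac{2\pi i}{\log q}\mathbb{Z}$, or $s_r\in\mathbb{Z}_{\le 0}+\frac{2\pi i}{\log q}(\mathbb{Z}\setminus\{0\})$, or $s_j+\cdots+s_r\in\mathbb{Z}_{\le r-j+1}+\frac{2\pi i}{\log q}\mathbb{Z}$ for some $j<r$). In particular $\zeta_q(s)=\sum_{n>0} q^{(s-1)n}/[n]_q^s$. *)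

theory Defs
  imports "HOL-Complex_Analysis.Complex_Analysis"
begin

definition q_int :: "real \<Rightarrow> nat \<Rightarrow> real" where
  "q_int q m = (1 - q ^ m) / (1 - q)"

text \<open>
  Points of \<open>\<complex>\<^sup>r\<close> are lists of length \<open>r\<close>; the entry \<open>s\<^sub>j\<close> is \<open>ss ! (j - 1)\<close>.
  For \<open>0 < q < 1\<close> both bases below are positive reals, so \<open>powr\<close> is the principal power.
\<close>

definition zeta_q_series :: "real \<Rightarrow> complex list \<Rightarrow> complex" where
  "zeta_q_series q ss =
     (\<Sum>\<^sub>\<infinity>ns | length ns = length ss \<and> sorted_wrt (<) (0 # ns).
        \<Prod>j<length ss.
          of_real q powr ((ss ! j - 1) * of_nat (ns ! j)) /
          of_real (q_int q (ns ! j)) powr (ss ! j))"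

definition zeta_q_conv :: "nat \<Rightarrow> complex list set" where
  "zeta_q_conv r =
     {ss. length ss = r \<and> (\<forall>k\<in>{1..r}. Re (sum_list (drop (r - k) ss)) > real k)}"

definition q_period :: "real \<Rightarrow> complex" where
  "q_period q = 2 * of_real pi * \<i> / of_real (ln q)"

definition zeta_q_sing :: "real \<Rightarrow> nat \<Rightarrow> complex list set" where
  "zeta_q_sing q r =
     {ss. length ss = r \<and> r \<ge> 1 \<and>
       ((\<exists>m::int. last ss = 1 + of_int m * q_period q) \<or>
        (\<exists>k m::int. k \<le> 0 \<and> m \<noteq> 0 \<and> last ss = of_int k + of_int m * q_period q) \<or>
        (\<exists>j\<in>{1..<r}. \<exists>k m::int. k \<le> int r - int j + 1 \<and>
           sum_list (drop (j - 1) ss) = of_int k + of_int m * q_period q))}"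

text \<open>
  Holomorphy in \<open>r\<close> complex variables: jointly continuous and holomorphic in each variable
  separately. Joint continuity is stated via the product topology on \<open>nat \<Rightarrow> complex\<close>, of
  which only the first \<open>r\<close> coordinates matter.
\<close>

definition holomorphic_in_vars :: "nat \<Rightarrow> (complex list \<Rightarrow> complex) \<Rightarrow> complex list set \<Rightarrow> bool" where
  "holomorphic_in_vars r F D \<longleftrightarrow>
     continuous_on {v :: nat \<Rightarrow> complex. map v [0..<r] \<in> D} (\<lambda>v. F (map v [0..<r])) \<and>
     (\<forall>ss\<in>D. \<forall>j<r. (\<lambda>z. F (ss[j := z])) holomorphic_on {z. ss[j := z] \<in> D})"

definition is_zeta_q_continuation :: "real \<Rightarrow> nat \<Rightarrow> (complex list \<Rightarrow> complex) \<Rightarrow> bool" where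
  "is_zeta_q_continuation q r F \<longleftrightarrow>
     holomorphic_in_vars r F ({ss. length ss = r} - zeta_q_sing q r) \<and>
     (\<forall>ss\<in>zeta_q_conv r. F ss = zeta_q_series q ss)"

text \<open>
  The singular set is a locally finite union of complex hyperplanes, so its complement is
  connected and the continuation is unique there; on the singular set the value is unspecified.
\<close>

definition zeta_q :: "real \<Rightarrow> complex list \<Rightarrow> complex" where
  "zeta_q q ss =
     (if ss \<in> zeta_q_conv (length ss) then zeta_q_series q ss
      else (SOME F. is_zeta_q_continuation q (length ss) F) ss)"

end

theory Submission
  imports Defs
begin

text \<open>
  Write \<open>x\<^sub>m = [m]\<^sub>q / q\<^sup>m\<close>, so that the \<open>m\<close>-th term of \<open>\<zeta>\<^sub>q(s)\<close> is \<open>t\<^sub>m(s) = q\<^bsup>-m\<^esup> x\<^sub>m\<^bsup>-s\<^esup>\<close>. For \<open>Re s > 2\<close>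
  both double series are single sums \<open>\<Sum>\<^sub>m t\<^sub>m(s) w\<^sub>n(m)\<close>, with weights
  \<open>\<Sum>\<^bsub>k>m\<^esub> (x\<^sub>m/x\<^sub>k)\<^bsup>n+2\<^esup> q\<^bsup>-k\<^esup>\<close> for \<open>\<zeta>\<^sub>q(s-n-2, n+2)\<close> and \<open>\<Sum>\<^bsub>0<k<m\<^esub> (x\<^sub>k/x\<^sub>m)\<^sup>n q\<^bsup>-k\<^esup>\<close> for \<open>\<zeta>\<^sub>q(-n, s+n)\<close>.
  Each weight grows like \<open>q\<^bsup>-m\<^esup>\<close>, but both have the same leading term
  \<open>q\<^bsup>-m\<^esup> q\<^bsup>n+1\<^esup> / (1 - q\<^bsup>n+1\<^esup>)\<close>, and their difference is \<open>O((n+2) q\<^sup>n)\<close> uniformly in \<open>m\<close>. Hence the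
  difference of the two zeta values continues to \<open>Re s > 1\<close> as a convergent single sum, and the sum
  over \<open>n\<close> may be taken termwise. As \<open>x\<^bsub>m+k\<^esub> - x\<^sub>m = x\<^sub>k / q\<^sup>m\<close>, the geometric series over \<open>n\<close>
  telescope and the weight differences add up to \<open>1\<close>.

  The continuation of the double zeta function on the whole complement of its singular set comes from
  expanding \<open>(1 - q\<^sup>m)\<^bsup>-a\<^esup> (1 - q\<^sup>k)\<^bsup>-b\<^esup>\<close> binomially and summing the geometric series in \<open>m\<close> and \<open>k\<close>.
\<close>

section \<open>Infinite sums\<close>

lemma summable_on_Times_mult:
  fixes f :: "'a \<Rightarrow> real" and g :: "'b \<Rightarrow> real"
  assumes "f summable_on A" "g summable_on B"
    and "\<And>x. x \<in> A \<Longrightarrow> f x \<ge> 0" "\<And>y. y \<in> B \<Longrightarrow> g y \<ge> 0"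
  shows "(\<lambda>(x, y). f x * g y) summable_on A \<times> B"
proof (rule summable_on_SigmaI)
  show "((\<lambda>y. case (x, y) of (x, y) \<Rightarrow> f x * g y) has_sum f x * infsum g B) B" for x
    using has_sum_cmult_right[OF has_sum_infsum[OF assms(2)]] by simp
  show "(\<lambda>x. f x * infsum g B) summable_on A"
    using assms(1) by (rule summable_on_cmult_left)
qed (use assms in auto)

lemma has_sum_Times_mult:
  fixes f :: "'a \<Rightarrow> complex" and g :: "'b \<Rightarrow> complex"
  assumes f: "(f has_sum a) A" "(\<lambda>x. norm (f x)) summable_on A"
    and g: "(g has_sum b) B" "(\<lambda>x. norm (g x)) summable_on B"
  shows "((\<lambda>(x, y). f x * g y) has_sum a * b) (A \<times> B)"
proof (rule has_sum_SigmaI)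
  show "((\<lambda>y. case (x, y) of (x, y) \<Rightarrow> f x * g y) has_sum f x * b) B" for x
    using has_sum_cmult_right[OF g(1)] by simp
  show "((\<lambda>x. f x * b) has_sum a * b) A"
    using f(1) by (rule has_sum_cmult_left)
  have norms: "(\<lambda>(x, y). norm (f x) * norm (g y)) summable_on A \<times> B"
    using f(2) g(2) by (intro summable_on_Times_mult) auto
  show "(\<lambda>(x, y). f x * g y) summable_on A \<times> B"
    by (rule abs_summable_summable) (use norms in \<open>simp add: case_prod_unfold norm_mult\<close>)
qed

lemma summable_on_geometric:
  fixes r :: real
  assumes "0 \<le> r" "r < 1"
  shows "(\<lambda>n. r ^ n) summable_on UNIV"
  using assms by (intro norm_summable_imp_summable_on) (simp add: summable_geometric)

lemma has_sum_geometric_Suc: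
  fixes z :: complex
  assumes "norm z < 1"
  shows "((\<lambda>n. z ^ Suc n) has_sum z / (1 - z)) UNIV"
    and "(\<lambda>n. norm (z ^ Suc n)) summable_on UNIV"
proof -
  have "(\<lambda>n. norm z * norm z ^ n) summable_on UNIV"
    using assms by (intro summable_on_cmult_right summable_on_geometric) auto
  then show "(\<lambda>n. norm (z ^ Suc n)) summable_on UNIV"
    by (simp add: norm_mult norm_power)
  have "summable (\<lambda>n. norm (z ^ Suc n))"
    using assms by (simp add: norm_mult norm_power summable_mult summable_geometric)
  moreover have "(\<lambda>n. z ^ Suc n) sums (z / (1 - z))"
    using sums_mult[OF geometric_sums[OF assms], of z] by simp
  ultimately show "((\<lambda>n. z ^ Suc n) has_sum z / (1 - z)) UNIV"
    by (rule norm_summable_imp_has_sum)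
qed

text \<open>Continuity is local: in a \<open>heine_borel\<close> space every point of the open set
  has a compact ball around it, on which the M-test gives uniform convergence. So majorants on
  compact sets are enough.\<close>

lemma continuous_on_infsum_compact:
  fixes f :: "'i \<Rightarrow> 'a::heine_borel \<Rightarrow> complex"
  assumes S: "open S" and cont: "\<And>i. i \<in> I \<Longrightarrow> continuous_on S (f i)"
    and bound: "\<And>K. compact K \<Longrightarrow> K \<subseteq> S \<Longrightarrow>
      \<exists>M. M summable_on I \<and> (\<forall>i\<in>I. \<forall>x\<in>K. norm (f i x) \<le> M i)"
  shows "continuous_on S (\<lambda>x. \<Sum>\<^sub>\<infinity>i\<in>I. f i x)"
proof -
  have "isCont (\<lambda>x. \<Sum>\<^sub>\<infinity>i\<in>I. f i x) x" if "x \<in> S" for x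
  proof -
    obtain r where r: "r > 0" "cball x r \<subseteq> S"
      using S \<open>x \<in> S\<close> by (meson open_contains_cball)
    obtain M where M: "M summable_on I" "\<And>i y. i \<in> I \<Longrightarrow> y \<in> cball x r \<Longrightarrow> norm (f i y) \<le> M i"
      using bound[OF compact_cball r(2)] by auto
    have "continuous_on (cball x r) (\<lambda>x. \<Sum>\<^sub>\<infinity>i\<in>I. f i x)"
    proof (rule uniform_limit_theorem)
      show "uniform_limit (cball x r) (\<lambda>X y. \<Sum>i\<in>X. f i y) (\<lambda>y. \<Sum>\<^sub>\<infinity>i\<in>I. f i y) (finite_subsets_at_top I)"
        using M(2,1) by (rule Weierstrass_m_test_general)
      show "\<forall>\<^sub>F X in finite_subsets_at_top I. continuous_on (cball x r) (\<lambda>y. \<Sum>i\<in>X. f i y)"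
        by (intro eventually_finite_subsets_at_top_weakI continuous_on_sum
              continuous_on_subset[OF cont r(2)]) auto
    qed auto
    then show ?thesis
      using r(1) centre_in_ball[of x r] interior_maximal[OF ball_subset_cball open_ball, of x r]
      by (intro continuous_on_interior[of "cball x r"]) blast+
  qed
  then show ?thesis
    by (intro continuous_at_imp_continuous_on ballI)
qed

lemma holomorphic_on_infsum_compact:
  fixes f :: "'i \<Rightarrow> complex \<Rightarrow> complex"
  assumes S: "open S" and holo: "\<And>i. i \<in> I \<Longrightarrow> f i holomorphic_on S"
    and bound: "\<And>K. compact K \<Longrightarrow> K \<subseteq> S \<Longrightarrow>
      \<exists>M. M summable_on I \<and> (\<forall>i\<in>I. \<forall>x\<in>K. norm (f i x) \<le> M i)"
  shows "(\<lambda>x. \<Sum>\<^sub>\<infinity>i\<in>I. f i x) holomorphic_on S"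
proof -
  have "(\<lambda>x. \<Sum>\<^sub>\<infinity>i\<in>I. f i x) field_differentiable (at x)" if "x \<in> S" for x
  proof -
    obtain r where r: "r > 0" "cball x r \<subseteq> S"
      using S \<open>x \<in> S\<close> by (meson open_contains_cball)
    obtain M where M: "M summable_on I" "\<And>i y. i \<in> I \<Longrightarrow> y \<in> cball x r \<Longrightarrow> norm (f i y) \<le> M i"
      using bound[OF compact_cball r(2)] by auto
    have "(\<lambda>x. \<Sum>\<^sub>\<infinity>i\<in>I. f i x) holomorphic_on ball x r"
    proof (rule holomorphic_uniform_limit)
      show "uniform_limit (cball x r) (\<lambda>X y. \<Sum>i\<in>X. f i y) (\<lambda>y. \<Sum>\<^sub>\<infinity>i\<in>I. f i y) (finite_subsets_at_top I)"
        using M(2,1) by (rule Weierstrass_m_test_general)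
      have "f i holomorphic_on cball x r" "f i holomorphic_on ball x r" if "i \<in> I" for i
        using holomorphic_on_subset[OF holo[OF that]] r(2) ball_subset_cball[of x r] by blast+
      then show "\<forall>\<^sub>F X in finite_subsets_at_top I. continuous_on (cball x r) (\<lambda>y. \<Sum>i\<in>X. f i y) \<and>
          (\<lambda>y. \<Sum>i\<in>X. f i y) holomorphic_on ball x r"
        by (intro eventually_finite_subsets_at_top_weakI conjI continuous_on_sum holomorphic_on_sum
              holomorphic_on_imp_continuous_on) auto
    qed auto
    then show ?thesis
      using r(1) by (simp add: holomorphic_on_imp_differentiable_at)
  qed
  then show ?thesis
    using S by (auto simp: holomorphic_on_open field_differentiable_def)
qed

text \<open>Subtracting the series shifted by \<open>m\<close> cancels all but finitely many terms.
  Indices start at 1 because \<open>f\<close> will be the reciprocal of \<open>q_quot\<close>, which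
  vanishes at 0.\<close>

lemma sums_diff_shift:
  fixes f :: "nat \<Rightarrow> real"
  assumes "summable f"
  shows "(\<lambda>j. f (Suc j) - f (m + Suc j)) sums (\<Sum>k=1..m. f k)"
proof -
  have s: "(\<lambda>j. f (Suc j)) sums (\<Sum>j. f (Suc j))"
    using assms by (simp add: summable_Suc_iff summable_sums)
  have "(\<lambda>j. f (Suc (j + m))) sums ((\<Sum>j. f (Suc j)) - (\<Sum>j<m. f (Suc j)))"
    using sums_split_initial_segment[OF s, of m] by simp
  from sums_diff[OF s this] show ?thesis
    by (simp add: add.commute sum.atLeast1_atMost_eq)
qed

lemma one_minus_power_le:
  fixes x :: real
  assumes "0 \<le> x" "x \<le> 1"
  shows "1 - x ^ n \<le> real n * (1 - x)"
  using Bernoulli_inequality[of "x - 1" n] assms by (simp add: algebra_simps)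

text \<open>Below \<open>L\<close> compactness bounds \<open>f l\<close>, and these finitely many
  ratios to \<open>g l\<close> are added to the constant. It serves coefficients whose closed
  formula is used only for large index.\<close>

lemma uniform_bound_from_tail:
  fixes f :: "nat \<Rightarrow> 'a::topological_space \<Rightarrow> complex"
  assumes "compact K" and cont: "\<And>l. continuous_on K (f l)" and g: "\<And>l. g l > (0::real)"
    and tail: "\<And>l x. l \<ge> L \<Longrightarrow> x \<in> K \<Longrightarrow> norm (f l x) \<le> C * g l"
  obtains C' where "\<And>l x. x \<in> K \<Longrightarrow> norm (f l x) \<le> C' * g l"
proof -
  have "\<exists>B. \<forall>x\<in>K. norm (f l x) \<le> B" for l
    using compact_imp_bounded[OF compact_continuous_image[OF cont \<open>compact K\<close>]]
    by (auto simp: bounded_iff)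
  then obtain B where B: "\<And>l x. x \<in> K \<Longrightarrow> norm (f l x) \<le> B l"
    by metis
  define C' where "C' = \<bar>C\<bar> + (\<Sum>l<L. \<bar>B l\<bar> / g l)"
  have sum_nonneg: "(\<Sum>l<L. \<bar>B l\<bar> / g l) \<ge> 0"
    using g by (intro sum_nonneg) (simp add: less_imp_le)
  have "norm (f l x) \<le> C' * g l" if "x \<in> K" for l x
  proof (cases "l \<ge> L")
    case True
    then have "norm (f l x) \<le> C * g l"
      using tail that by blast
    also have "\<dots> \<le> C' * g l"
      using sum_nonneg g[of l] by (intro mult_right_mono) (auto simp: C'_def)
    finally show ?thesis .
  next
    case False
    have "norm (f l x) \<le> \<bar>B l\<bar> / g l * g l"
      using B[OF that, of l] g[of l] by simp
    also have "\<bar>B l\<bar> / g l \<le> (\<Sum>l<L. \<bar>B l\<bar> / g l)"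
      using False g by (intro member_le_sum) (auto simp: less_imp_le)
    then have "\<bar>B l\<bar> / g l * g l \<le> C' * g l"
      using g[of l] by (intro mult_right_mono) (auto simp: C'_def)
    finally show ?thesis .
  qed
  then show ?thesis
    using that by blast
qed

section \<open>Binomial series with negative exponent\<close>

text \<open>The coefficient of \<open>x ^ l\<close> in \<open>(1 - x) powr (- a)\<close>. Written
  with a rising factorial it has no alternating sign, so \<open>neg_binom R\<close> with
  \<open>R \<ge> norm a\<close> dominates it.\<close>

definition neg_binom :: "'a::field_char_0 \<Rightarrow> nat \<Rightarrow> 'a" where
  "neg_binom a l = pochhammer a l / fact l"

lemma neg_binom_eq_gbinomial: "neg_binom a l * x ^ l = (- a gchoose l) * (- x) ^ l"
proof -
  have "(- 1) ^ l * (- x) ^ l = x ^ l"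
    by (simp flip: power_mult_distrib)
  then show ?thesis
    by (simp add: neg_binom_def gbinomial_pochhammer mult_ac)
qed

lemma norm_pochhammer_le:
  fixes a :: complex
  assumes "norm a \<le> R"
  shows "norm (pochhammer a l) \<le> pochhammer R l"
proof -
  have "norm (a + of_nat i) \<le> R + of_nat i" for i
    using norm_triangle_ineq[of a "of_nat i"] assms by simp
  then show ?thesis
    by (auto simp: pochhammer_prod prod_norm[symmetric] intro!: prod_mono)
qed

lemma norm_neg_binom_le:
  fixes a :: complex
  assumes "norm a \<le> R"
  shows "norm (neg_binom a l) \<le> neg_binom R l"
  using norm_pochhammer_le[OF assms] by (simp add: neg_binom_def norm_divide divide_right_mono)

lemma neg_binom_nonneg: "R \<ge> 0 \<Longrightarrow> neg_binom (R::real) l \<ge> 0"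
  by (auto simp: neg_binom_def pochhammer_prod intro!: divide_nonneg_pos prod_nonneg)

lemma neg_binom_summable:
  fixes R :: real
  assumes "R \<ge> 0" "0 \<le> x" "x < 1"
  shows "(\<lambda>l. neg_binom R l * x ^ l) summable_on UNIV"
proof -
  have "(\<lambda>l. neg_binom R l * x ^ l) sums (1 + (- x)) powr (- R)"
    unfolding neg_binom_eq_gbinomial using assms by (intro gen_binomial_real) auto
  then have "((\<lambda>l. neg_binom R l * x ^ l) has_sum (1 + (- x)) powr (- R)) UNIV"
    using assms neg_binom_nonneg by (intro sums_nonneg_imp_has_sum) auto
  then show ?thesis
    by (rule has_sum_imp_summable)
qed

lemma neg_binom_has_sum:
  fixes a :: complex and x :: real
  assumes "0 \<le> x" "x < 1"
  shows "((\<lambda>l. neg_binom a l * of_real (x ^ l)) has_sum of_real (1 - x) powr (- a)) UNIV"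
    and "(\<lambda>l. norm (neg_binom a l * of_real (x ^ l))) summable_on UNIV"
proof -
  have le: "norm (neg_binom a l * of_real (x ^ l)) \<le> neg_binom (norm a) l * x ^ l" for l
    using assms norm_neg_binom_le[of a "norm a" l] by (simp add: norm_mult norm_power mult_right_mono)
  from neg_binom_summable[OF norm_ge_zero assms, of a] le
  show abs: "(\<lambda>l. norm (neg_binom a l * of_real (x ^ l))) summable_on UNIV"
    by (rule Infinite_Sum.abs_summable_on_comparison_test')
  have "(\<lambda>l. neg_binom a l * of_real x ^ l) sums (1 + (- of_real x)) powr (- a)"
    unfolding neg_binom_eq_gbinomial using assms by (intro gen_binomial_complex) auto
  then have sums: "(\<lambda>l. neg_binom a l * of_real (x ^ l)) sums (of_real (1 - x) powr (- a))"
    by simp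
  have "summable (\<lambda>l. norm (neg_binom a l * of_real (x ^ l)))"
    using abs by (rule summable_on_imp_summable)
  then show "((\<lambda>l. neg_binom a l * of_real (x ^ l)) has_sum of_real (1 - x) powr (- a)) UNIV"
    using sums by (rule norm_summable_imp_has_sum)
qed

lemma holomorphic_on_pochhammer [holomorphic_intros]:
  "f holomorphic_on S \<Longrightarrow> (\<lambda>z. pochhammer (f z) n) holomorphic_on S"
  unfolding pochhammer_prod by (intro holomorphic_intros)

section \<open>Single-sum form of the double series\<close>

definition q_summand :: "real \<Rightarrow> complex \<Rightarrow> nat \<Rightarrow> complex" where
  "q_summand q s m = of_real q powr ((s - 1) * of_nat m) / of_real (q_int q m) powr s"

lemma zeta_q_series_single: "zeta_q_series q [s] = (\<Sum>\<^sub>\<infinity>i. q_summand q s (Suc i))"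
  unfolding zeta_q_series_def
proof (rule infsum_reindex_bij_witness[of _ "\<lambda>i. [Suc i]" "\<lambda>ns. hd ns - 1"])
  fix ns :: "nat list"
  assume "ns \<in> {ns. length ns = length [s] \<and> sorted_wrt (<) (0 # ns)}"
  then obtain m where "ns = [m]" "m > 0"
    by (auto simp: length_Suc_conv)
  then show "[Suc (hd ns - 1)] = ns"
    "q_summand q s (Suc (hd ns - 1)) =
      (\<Prod>j<length [s]. of_real q powr (([s] ! j - 1) * of_nat (ns ! j)) / of_real (q_int q (ns ! j)) powr [s] ! j)"
    by (auto simp: q_summand_def)
qed auto

text \<open>A pair \<open>m < k\<close> is coded by \<open>m = Suc i\<close> and
  \<open>k = Suc i + Suc j\<close>, which leaves no side condition on the indices.\<close>

lemma zeta_q_series_pair: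
  "zeta_q_series q [a, b] = (\<Sum>\<^sub>\<infinity>(i, j). q_summand q a (Suc i) * q_summand q b (Suc i + Suc j))"
  unfolding zeta_q_series_def
proof (rule infsum_reindex_bij_witness[of _ "\<lambda>(i, j). [Suc i, Suc i + Suc j]"
      "\<lambda>ns. (ns ! 0 - 1, ns ! 1 - ns ! 0 - 1)"])
  fix ns :: "nat list"
  assume "ns \<in> {ns. length ns = length [a, b] \<and> sorted_wrt (<) (0 # ns)}"
  then obtain m k where "ns = [m, k]" "0 < m" "m < k"
    by (auto simp: length_Suc_conv)
  then show "(case (ns ! 0 - 1, ns ! 1 - ns ! 0 - 1) of (i, j) \<Rightarrow> [Suc i, Suc i + Suc j]) = ns"
    "(case (ns ! 0 - 1, ns ! 1 - ns ! 0 - 1) of (i, j) \<Rightarrow> q_summand q a (Suc i) * q_summand q b (Suc i + Suc j)) =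
      (\<Prod>j<length [a, b]. of_real q powr (([a, b] ! j - 1) * of_nat (ns ! j)) / of_real (q_int q (ns ! j)) powr [a, b] ! j)"
    by (auto simp: q_summand_def lessThan_Suc mult_ac)
qed auto

section \<open>q-integers, their quotients and absolute convergence\<close>

locale q_base =
  fixes q :: real
  assumes q_pos: "0 < q" and q_less_1: "q < 1"
begin

definition q_quot :: "nat \<Rightarrow> real" where
  "q_quot m = q_int q m / q ^ m"

lemma power_less_1: "m > 0 \<Longrightarrow> q ^ m < 1"
  using q_pos q_less_1 by (simp add: power_less_one_iff)

lemma q_int_pos: "m > 0 \<Longrightarrow> q_int q m > 0"
  using q_less_1 power_less_1 by (simp add: q_int_def)

lemma q_quot_pos: "m > 0 \<Longrightarrow> q_quot m > 0"
  using q_pos q_int_pos by (simp add: q_quot_def)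

text \<open>\<open>q_quot\<close> is affine in the reciprocal power of \<open>q\<close>. This
  relation is what makes the sums of the weights telescope.\<close>

lemma q_quot_diff: "q_quot (m + k) - q_quot m = q_quot k / q ^ m"
proof -
  have "q_quot n = (1 / q ^ n - 1) / (1 - q)" for n
    using q_pos by (simp add: q_quot_def q_int_def field_simps)
  then show ?thesis
    by (simp add: power_add diff_divide_distrib mult_ac)
qed

lemma q_int_ge_1: "m > 0 \<Longrightarrow> q_int q m \<ge> 1"
  using q_pos q_less_1 power_decreasing[of 1 m q] by (simp add: q_int_def field_simps)

lemma q_int_le: "q_int q m \<le> 1 / (1 - q)"
  using q_pos q_less_1 by (simp add: q_int_def field_simps)

lemma of_real_q_powr: "complex_of_real q powr w = exp (w * of_real (ln q))"
  using q_pos by (simp add: powr_def Ln_of_real)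

lemma q_powr_mult_nat: "complex_of_real q powr (w * of_nat m) = (of_real q powr w) ^ m"
  by (simp add: of_real_q_powr exp_of_nat_mult[symmetric] mult_ac)

lemma norm_q_powr: "norm (complex_of_real q powr w) = q powr Re w"
  using q_pos by (simp add: norm_powr_real_powr)

text \<open>As a function of \<open>s\<close> the summand is a pure exponential with base
  \<open>1 / q_quot m\<close>; real logarithms of the positive bases make this exact for complex
  exponents.\<close>

lemma q_summand_shift:
  assumes "m > 0"
  shows "q_summand q (s + t) m = q_summand q s m * of_real (q_quot m) powr (- t)"
proof -
  have "ln (q_quot m) = ln (q_int q m) - m * ln q"
    using q_pos q_int_pos[OF assms] by (simp add: q_quot_def ln_div ln_realpow)
  then have quot: "complex_of_real (q_quot m) powr (- t) = exp (- t * (of_real (ln (q_int q m)) - of_nat m * of_real (ln q)))"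
    using q_quot_pos[OF assms] by (simp add: powr_def Ln_of_real)
  show ?thesis
    unfolding quot using q_pos q_int_pos[OF assms]
    by (simp add: q_summand_def powr_def Ln_of_real exp_diff[symmetric] exp_add[symmetric] algebra_simps)
qed

lemma q_summand_0:
  assumes "m > 0"
  shows "q_summand q 0 m = 1 / of_real (q ^ m)"
  using assms q_pos q_int_pos[OF assms]
  by (simp add: q_summand_def powr_minus powr_nat' field_simps)

lemma q_summand_add_nat:
  assumes "m > 0"
  shows "q_summand q (s + of_nat n) m = q_summand q s m / of_real (q_quot m ^ n)"
  using q_summand_shift[OF assms, of s "of_nat n"] q_quot_pos[OF assms]
  by (simp add: powr_minus powr_nat' field_simps)

lemma norm_q_summand:
  assumes "m > 0"
  shows "norm (q_summand q s m) = (q powr (Re s - 1)) ^ m / q_int q m powr Re s"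
  using assms q_pos q_int_pos[OF assms]
  by (simp add: q_summand_def q_powr_mult_nat norm_divide norm_power norm_q_powr norm_powr_real_powr)

text \<open>\<open>q_int q m\<close> lies between 1 and \<open>1 / (1 - q)\<close>, so its powers
  are bounded by the upper end with exponent \<open>\<bar>Re s\<bar>\<close>, whatever the sign of
  \<open>Re s\<close>.\<close>

lemma norm_q_summand_le:
  assumes "m > 0"
  shows "norm (q_summand q s m) \<le> (1 / (1 - q)) powr \<bar>Re s\<bar> * (q powr (Re s - 1)) ^ m"
proof -
  have "q_int q m powr (- Re s) \<le> (1 / (1 - q)) powr \<bar>Re s\<bar>"
    using q_int_ge_1[OF assms] q_int_le[of m]
    by (intro order_trans[OF powr_mono[of "- Re s" "\<bar>Re s\<bar>"] powr_mono2]) auto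
  then show ?thesis
    unfolding norm_q_summand[OF assms] divide_inverse powr_minus[symmetric]
    by (subst mult.commute) (intro mult_right_mono, auto)
qed

text \<open>The majorant is a product of geometric series with ratios \<open>u\<close> and
  \<open>v\<close>, and the two hypotheses say that both are below 1. The larger index also contains
  \<open>i\<close>, so \<open>u\<close> collects the exponents of both variables.\<close>

lemma summable_on_q_summand_pair:
  assumes "Re b > 1" "Re (a + b) > 2"
  shows "(\<lambda>(i, j). q_summand q a (Suc i) * q_summand q b (Suc i + Suc j)) summable_on UNIV"
proof -
  define C where "C = (1 / (1 - q)) powr \<bar>Re a\<bar> * (1 / (1 - q)) powr \<bar>Re b\<bar>"
  define u where "u = q powr (Re a - 1) * q powr (Re b - 1)"
  define v where "v = q powr (Re b - 1)"
  have u: "u = q powr (Re (a + b) - 2)"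
    by (simp add: u_def flip: powr_add)
  have uv: "0 \<le> u" "u < 1" "0 \<le> v" "v < 1"
    unfolding u v_def using assms q_pos q_less_1 by (auto simp: powr01_less_one)
  have "(\<lambda>(i, j). C * u * v * (u ^ i * v ^ j)) summable_on UNIV \<times> UNIV"
    using summable_on_cmult_right[OF summable_on_Times_mult[OF summable_on_geometric summable_on_geometric, of u v], of "C * u * v"] uv
    by (simp add: case_prod_unfold)
  moreover have "norm (q_summand q a (Suc i) * q_summand q b (Suc i + Suc j)) \<le> C * u * v * (u ^ i * v ^ j)" for i j
  proof -
    have "norm (q_summand q a (Suc i) * q_summand q b (Suc i + Suc j))
        \<le> ((1 / (1 - q)) powr \<bar>Re a\<bar> * (q powr (Re a - 1)) ^ Suc i) *
          ((1 / (1 - q)) powr \<bar>Re b\<bar> * (q powr (Re b - 1)) ^ (Suc i + Suc j))"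
      unfolding norm_mult using q_pos by (intro mult_mono norm_q_summand_le) auto
    also have "\<dots> = C * u * v * (u ^ i * v ^ j)"
      by (simp add: C_def u_def v_def power_add power_mult_distrib mult_ac)
    finally show ?thesis .
  qed
  ultimately have "(\<lambda>p. norm (case p of (i, j) \<Rightarrow> q_summand q a (Suc i) * q_summand q b (Suc i + Suc j))) summable_on UNIV \<times> UNIV"
    by (intro Infinite_Sum.abs_summable_on_comparison_test'[where g = "\<lambda>(i, j). C * u * v * (u ^ i * v ^ j)"]) auto
  from abs_summable_summable[OF this] show ?thesis by simp
qed

section \<open>The weights and their common leading term\<close>

definition upper_weight :: "nat \<Rightarrow> nat \<Rightarrow> real" where
  "upper_weight n m = (\<Sum>\<^sub>\<infinity>j. (q_quot m / q_quot (m + Suc j)) ^ (n + 2) / q ^ (m + Suc j))"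

definition lower_weight :: "nat \<Rightarrow> nat \<Rightarrow> real" where
  "lower_weight n m = (\<Sum>k\<in>{1..<m}. (q_quot k / q_quot m) ^ n / q ^ k)"

text \<open>Both weights reduce to this when the ratios of the form
  \<open>(1 - q ^ a) / (1 - q ^ b)\<close> are replaced by 1 and the geometric series runs to
  infinity.\<close>

definition weight_limit :: "nat \<Rightarrow> nat \<Rightarrow> real" where
  "weight_limit n m = q ^ Suc n / (1 - q ^ Suc n) / q ^ m"

lemma power_nonneg_le_1: "0 \<le> q ^ m" "q ^ m \<le> 1"
  using q_pos q_less_1 by (auto simp: power_le_one)

lemma power_Suc_le_q: "q ^ Suc m \<le> q"
  using q_pos power_nonneg_le_1[of m] by (simp add: mult_left_le)

lemma q_quot_ratio:
  assumes "m > 0"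
  shows "q_quot m / q_quot (m + j) = q ^ j * ((1 - q ^ m) / (1 - q ^ (m + j)))"
  using assms q_pos q_less_1 by (simp add: q_quot_def q_int_def power_add)

text \<open>One of the \<open>n + 2\<close> factors \<open>q ^ Suc j\<close> cancels against
  \<open>q ^ (m + Suc j)\<close>, which leaves the geometric term of \<open>weight_limit\<close> and
  a power of a ratio close to 1.\<close>

lemma upper_weight_term:
  assumes "m > 0"
  shows "(q_quot m / q_quot (m + Suc j)) ^ (n + 2) / q ^ (m + Suc j) =
    (q ^ Suc n) ^ Suc j * ((1 - q ^ m) / (1 - q ^ (m + Suc j))) ^ (n + 2) / q ^ m"
proof -
  have "(q ^ Suc j) ^ (n + 2) = (q ^ Suc n) ^ Suc j * q ^ Suc j"
    by (simp flip: power_mult power_add add: algebra_simps)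
  moreover have "P * q ^ Suc j * R / (M * q ^ Suc j) = P * R / M" for P R M :: real
    using q_pos by simp
  ultimately show ?thesis
    by (simp only: q_quot_ratio[OF assms] power_mult_distrib power_add[of q m])
qed

text \<open>Counted downwards from \<open>m\<close>, the terms have the same ratio
  \<open>q ^ Suc n\<close> as those of the upper weight: the division by \<open>q ^ (m - j)\<close>
  supplies the extra factor \<open>q ^ j\<close>.\<close>

lemma lower_weight_term:
  assumes "0 < j" "j < m"
  shows "(q_quot (m - j) / q_quot m) ^ n / q ^ (m - j) =
    (q ^ Suc n) ^ j * ((1 - q ^ (m - j)) / (1 - q ^ m)) ^ n / q ^ m"
proof -
  define \<sigma> where "\<sigma> = (1 - q ^ (m - j)) / (1 - q ^ m)"
  have "q_quot (m - j) / q_quot m = q ^ j * \<sigma>"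
    using q_quot_ratio[of "m - j" j] assms by (simp add: \<sigma>_def)
  then have "(q_quot (m - j) / q_quot m) ^ n / q ^ (m - j) = (q ^ j) ^ n * \<sigma> ^ n * (1 / q ^ (m - j))"
    by (simp add: power_mult_distrib)
  also have "1 / q ^ (m - j) = q ^ j / q ^ m"
    using assms q_pos by (simp add: power_diff)
  also have "(q ^ j) ^ n * \<sigma> ^ n * (q ^ j / q ^ m) = (q ^ j) ^ n * q ^ j * \<sigma> ^ n / q ^ m"
    by simp
  also have "(q ^ j) ^ n * q ^ j = (q ^ Suc n) ^ j"
    by (simp flip: power_mult power_add add: algebra_simps)
  finally show ?thesis
    by (simp only: \<sigma>_def)
qed

lemma weight_limit_has_sum: "((\<lambda>j. (q ^ Suc n) ^ Suc j / q ^ m) has_sum weight_limit n m) UNIV"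
proof -
  have "norm (q ^ Suc n) < 1"
    using q_pos power_less_1[of "Suc n"] by simp
  from sums_divide[OF sums_mult[OF geometric_sums[OF this], of "q ^ Suc n"], of "q ^ m"]
  have "(\<lambda>j. (q ^ Suc n) ^ Suc j / q ^ m) sums weight_limit n m"
    by (simp add: weight_limit_def)
  then show ?thesis
    using q_pos by (intro sums_nonneg_imp_has_sum) auto
qed

text \<open>The deviation from 1 carries a factor \<open>q ^ m\<close>, which will cancel the growth
  \<open>1 / q ^ m\<close> of the weights.\<close>

lemma upper_ratio_bounds:
  assumes "m > 0"
  defines "\<rho> \<equiv> \<lambda>j. (1 - q ^ m) / (1 - q ^ (m + j))"
  shows "0 \<le> \<rho> j" "\<rho> j \<le> 1" "1 - \<rho> j \<le> q ^ m"
proof -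
  have less: "q ^ (m + j) < 1"
    using assms by (intro power_less_1) auto
  have "q ^ m * q ^ j \<le> q ^ m" "q ^ m * q ^ j \<le> q ^ j"
    using power_nonneg_le_1 by (auto simp: mult_left_le mult_left_le_one_le)
  then have le: "q ^ (m + j) \<le> q ^ m" "q ^ (m + j) \<le> q ^ j"
    by (simp_all add: power_add)
  show "0 \<le> \<rho> j" "\<rho> j \<le> 1"
    using less le power_nonneg_le_1[of m] by (auto simp: \<rho>_def)
  have "1 - \<rho> j = q ^ m * ((1 - q ^ j) / (1 - q ^ (m + j)))"
    using less by (simp add: \<rho>_def field_simps power_add)
  also have "\<dots> \<le> q ^ m * 1"
    using less le power_nonneg_le_1[of m] by (intro mult_left_mono) auto
  finally show "1 - \<rho> j \<le> q ^ m" by simp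
qed

lemma upper_weight_has_sum:
  assumes "m > 0"
  shows "((\<lambda>j. (q_quot m / q_quot (m + Suc j)) ^ (n + 2) / q ^ (m + Suc j)) has_sum upper_weight n m) UNIV"
  unfolding upper_weight_def
proof (intro has_sum_infsum summable_on_comparison_test[OF has_sum_imp_summable[OF weight_limit_has_sum[of n m]]])
  fix j
  show "(q_quot m / q_quot (m + Suc j)) ^ (n + 2) / q ^ (m + Suc j) \<le> (q ^ Suc n) ^ Suc j / q ^ m"
    unfolding upper_weight_term[OF assms]
    using q_pos upper_ratio_bounds[OF assms, of "Suc j"]
    by (intro divide_right_mono mult_left_le power_le_one) auto
  show "0 \<le> (q_quot m / q_quot (m + Suc j)) ^ (n + 2) / q ^ (m + Suc j)"
    using q_pos q_quot_pos[OF assms] q_quot_pos[of "m + Suc j"] by auto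
qed

text \<open>Relative to the geometric term the error is \<open>1 - \<rho> j ^ (n + 2)\<close>, at
  most \<open>(n + 2) * q ^ m\<close> by Bernoulli; the \<open>q ^ m\<close> makes the result
  uniform in \<open>m\<close>.\<close>

lemma upper_weight_approx:
  assumes "m > 0"
  shows "\<bar>weight_limit n m - upper_weight n m\<bar> \<le> (real n + 2) * q ^ n / (1 - q)"
proof -
  define \<rho> where "\<rho> = (\<lambda>j. (1 - q ^ m) / (1 - q ^ (m + Suc j)))"
  define D where "D = (\<lambda>j. (q ^ Suc n) ^ Suc j / q ^ m - (q ^ Suc n) ^ Suc j * \<rho> j ^ (n + 2) / q ^ m)"
  have D: "(D has_sum (weight_limit n m - upper_weight n m)) UNIV"
    unfolding D_def using has_sum_add[OF weight_limit_has_sum[of n m] has_sum_uminusI[OF upper_weight_has_sum[OF assms, of n]]]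
    unfolding upper_weight_term[OF assms] \<rho>_def by simp
  have \<rho>: "0 \<le> \<rho> j" "\<rho> j \<le> 1" "1 - \<rho> j \<le> q ^ m" for j
    using upper_ratio_bounds[OF assms, of "Suc j"] by (auto simp: \<rho>_def)
  have D_eq: "D j = (q ^ Suc n) ^ Suc j * (1 - \<rho> j ^ (n + 2)) / q ^ m" for j
    by (simp add: D_def right_diff_distrib diff_divide_distrib)
  have D_nonneg: "D j \<ge> 0" for j
    unfolding D_eq using q_pos power_le_one[OF \<rho>(1,2)] by (intro divide_nonneg_nonneg mult_nonneg_nonneg) (auto simp del: power_Suc power_add_numeral2 simp: diff_ge_0_iff_ge)
  have D_le: "D j \<le> (real n + 2) * q ^ m * ((q ^ Suc n) ^ Suc j / q ^ m)" for j
  proof -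
    have "1 - \<rho> j ^ (n + 2) \<le> real (n + 2) * (1 - \<rho> j)"
      using \<rho> by (intro one_minus_power_le) auto
    also have "\<dots> \<le> (real n + 2) * q ^ m"
      using mult_left_mono[OF \<rho>(3)[of j], of "real n + 2"] by (simp add: add.commute)
    finally have "(q ^ Suc n) ^ Suc j / q ^ m * (1 - \<rho> j ^ (n + 2)) \<le> (q ^ Suc n) ^ Suc j / q ^ m * ((real n + 2) * q ^ m)"
      using q_pos by (intro mult_left_mono) auto
    then show ?thesis
      unfolding D_eq by (simp add: mult_ac)
  qed
  have "weight_limit n m - upper_weight n m \<le> (real n + 2) * q ^ m * weight_limit n m"
    using D has_sum_cmult_right[OF weight_limit_has_sum[of n m]] D_le by (rule has_sum_mono)
  also have "\<dots> = (real n + 2) * (q ^ Suc n / (1 - q ^ Suc n))"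
    using q_pos by (simp add: weight_limit_def)
  also have "\<dots> \<le> (real n + 2) * (q ^ n / (1 - q))"
    using q_pos q_less_1 power_Suc_le_q[of n] by (intro mult_left_mono frac_le) (auto simp: mult_left_le_one_le)
  finally show ?thesis
    using has_sum_nonneg[OF D] D_nonneg by simp
qed

text \<open>Two errors give the two summands of the bound: the ratios \<open>\<sigma> j\<close>
  differ from 1, and the finite sum stops at \<open>m - 1\<close> where the geometric series goes
  on.\<close>

lemma lower_weight_approx:
  assumes "m > 0"
  shows "\<bar>weight_limit n m - lower_weight n m\<bar> \<le> real n * q ^ n / (1 - q)\<^sup>2 + q ^ n / (1 - q)"
proof -
  define \<sigma> where "\<sigma> = (\<lambda>j. (1 - q ^ (m - j)) / (1 - q ^ m))"
  define Q where "Q = q ^ Suc n"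
  have Q: "0 < Q" "Q < 1" "Q \<le> q"
    using q_pos power_less_1 power_Suc_le_q by (auto simp: Q_def simp del: power_Suc)
  have qm: "q ^ m < 1" "q ^ m \<le> q"
    using assms power_less_1 power_Suc_le_q[of "m - 1"] by auto
  have "lower_weight n m = (\<Sum>j\<in>{1..<m}. (q_quot (m - j) / q_quot m) ^ n / q ^ (m - j))"
    unfolding lower_weight_def by (rule sum.reindex_bij_witness[of _ "\<lambda>j. m - j" "\<lambda>j. m - j"]) auto
  also have "\<dots> = (\<Sum>j\<in>{1..<m}. Q ^ j * \<sigma> j ^ n / q ^ m)"
    unfolding Q_def \<sigma>_def by (intro sum.cong refl lower_weight_term) auto
  finally have lower: "lower_weight n m = (\<Sum>j\<in>{1..<m}. Q ^ j * \<sigma> j ^ n / q ^ m)" .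
  have geom: "(\<Sum>j\<in>{1..<m}. Q ^ j) = (Q - Q ^ m) / (1 - Q)"
    using sum_gp_strict[of Q m] Q assms
    by (simp add: sum.atLeast_Suc_lessThan lessThan_atLeast0 field_simps)
  have "weight_limit n m = ((\<Sum>j\<in>{1..<m}. Q ^ j) + Q ^ m / (1 - Q)) / q ^ m"
    unfolding geom weight_limit_def Q_def[symmetric] by (simp flip: add_divide_distrib)
  also have "\<dots> = (\<Sum>j\<in>{1..<m}. Q ^ j / q ^ m) + Q ^ m / q ^ m / (1 - Q)"
    by (simp add: add_divide_distrib sum_divide_distrib mult.commute)
  finally have diff: "weight_limit n m - lower_weight n m =
      (\<Sum>j\<in>{1..<m}. Q ^ j / q ^ m * (1 - \<sigma> j ^ n)) + Q ^ m / q ^ m / (1 - Q)"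
    by (simp add: lower right_diff_distrib sum_subtractf)
  have \<sigma>: "0 \<le> \<sigma> j" "\<sigma> j \<le> 1" "1 - \<sigma> j \<le> q ^ (m - j) / (1 - q)" for j
  proof -
    have "q ^ m \<le> q ^ (m - j)"
      using q_pos q_less_1 by (intro power_decreasing) auto
    then show "0 \<le> \<sigma> j" "\<sigma> j \<le> 1"
      using power_nonneg_le_1[of "m - j"] qm by (auto simp: \<sigma>_def)
    have "1 - \<sigma> j = (q ^ (m - j) - q ^ m) / (1 - q ^ m)"
      using qm by (simp add: \<sigma>_def field_simps)
    also have "\<dots> \<le> q ^ (m - j) / (1 - q)"
      using qm q_pos q_less_1 by (intro frac_le) auto
    finally show "1 - \<sigma> j \<le> q ^ (m - j) / (1 - q)" .
  qed
  have term_le: "Q ^ j / q ^ m * (1 - \<sigma> j ^ n) \<le> real n * q ^ n / (1 - q) * q ^ (j - 1)" if j: "j \<in> {1..<m}" for j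
  proof -
    have "1 - \<sigma> j ^ n \<le> real n * (1 - \<sigma> j)"
      using \<sigma> by (intro one_minus_power_le)
    also have "\<dots> \<le> real n * (q ^ (m - j) / (1 - q))"
      using \<sigma>(3) by (intro mult_left_mono) auto
    finally have "Q ^ j / q ^ m * (1 - \<sigma> j ^ n) \<le> Q ^ j / q ^ m * (real n * (q ^ (m - j) / (1 - q)))"
      using q_pos Q by (intro mult_left_mono) auto
    also have "\<dots> = real n * q ^ (n * j) / (1 - q)"
    proof -
      have "q ^ m = q ^ (m - j) * q ^ j"
        using j by (simp flip: power_add)
      moreover have "Q ^ j = q ^ (n * j) * q ^ j"
        by (simp only: Q_def power_mult[symmetric] power_add[symmetric]) (simp add: algebra_simps)
      ultimately show ?thesis
        using q_pos by simp
    qed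
    finally have le: "Q ^ j / q ^ m * (1 - \<sigma> j ^ n) \<le> real n * q ^ (n * j) / (1 - q)" .
    \<comment> \<open>For \<open>n \<ge> 1\<close> and \<open>j \<ge> 1\<close> one has
      \<open>n + (j - 1) \<le> n * j\<close>, which extracts \<open>q ^ n\<close> and leaves a
      geometric series in \<open>j\<close>. For \<open>n = 0\<close> the prefactor vanishes.\<close>
    have "real n * q ^ (n * j) \<le> real n * q ^ (n + (j - 1))"
    proof (cases "n = 0")
      case False
      then obtain n' where n': "n = Suc n'"
        by (cases n) auto
      obtain j' where j': "j = Suc j'"
        using j by (cases j) auto
      have "n + (j - 1) \<le> n * j"
        by (simp add: n' j')
      then show ?thesis
        using q_pos q_less_1 by (intro mult_left_mono power_decreasing) auto
    qed auto
    then have "real n * q ^ (n * j) / (1 - q) \<le> real n * q ^ (n + (j - 1)) / (1 - q)"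
      using q_less_1 by (intro divide_right_mono) auto
    with le show ?thesis
      by (simp add: power_add)
  qed
  have "(\<Sum>j\<in>{1..<m}. Q ^ j / q ^ m * (1 - \<sigma> j ^ n)) \<le> (\<Sum>j\<in>{1..<m}. real n * q ^ n / (1 - q) * q ^ (j - 1))"
    using term_le by (rule sum_mono)
  also have "\<dots> = real n * q ^ n / (1 - q) * (\<Sum>j\<in>{1..<m}. q ^ (j - 1))"
    by (simp add: sum_distrib_left)
  also have "(\<Sum>j\<in>{1..<m}. q ^ (j - 1)) = (\<Sum>j<m-1. q ^ j)"
    by (rule sum.reindex_bij_witness[of _ Suc "\<lambda>j. j - 1"]) auto
  also have "real n * q ^ n / (1 - q) * (\<Sum>j<m-1. q ^ j) \<le> real n * q ^ n / (1 - q) * (1 / (1 - q))"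
    using q_pos q_less_1 by (intro mult_left_mono) (auto simp: sum_gp_strict divide_right_mono)
  finally have sum_le: "(\<Sum>j\<in>{1..<m}. Q ^ j / q ^ m * (1 - \<sigma> j ^ n)) \<le> real n * q ^ n / (1 - q)\<^sup>2"
    by (simp add: power2_eq_square)
  have "Q ^ m / q ^ m = q ^ (n * m)"
    using q_pos by (simp add: Q_def power_mult_distrib power_mult)
  also have "\<dots> \<le> q ^ n"
    using q_pos q_less_1 assms by (intro power_decreasing) auto
  finally have "Q ^ m / q ^ m / (1 - Q) \<le> q ^ n / (1 - q)"
    using Q q_less_1 q_pos by (intro frac_le) auto
  moreover have "0 \<le> (\<Sum>j\<in>{1..<m}. Q ^ j / q ^ m * (1 - \<sigma> j ^ n)) + Q ^ m / q ^ m / (1 - Q)"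
    using Q q_pos power_le_one[OF \<sigma>(1,2)] by (intro add_nonneg_nonneg sum_nonneg mult_nonneg_nonneg) auto
  ultimately show ?thesis
    unfolding diff using sum_le by simp
qed

lemma weight_diff_le:
  assumes "m > 0"
  shows "\<bar>upper_weight n m - lower_weight n m\<bar> \<le> 3 / (1 - q)\<^sup>2 * ((real n + 2) * q ^ n)"
proof -
  define u where "u = 1 / (1 - q)"
  have u: "u \<ge> 1"
    using q_pos q_less_1 by (simp add: u_def)
  then have uu: "u \<le> u\<^sup>2" "0 \<le> u"
    by (auto simp: power2_eq_square)
  have "\<bar>upper_weight n m - lower_weight n m\<bar> \<le> (real n + 2) * q ^ n * u + (real n * q ^ n * u\<^sup>2 + q ^ n * u)"
    using upper_weight_approx[OF assms, of n] lower_weight_approx[OF assms, of n]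
    by (simp add: u_def power2_eq_square)
  \<comment> \<open>Since \<open>u \<ge> 1\<close>, each of the three error terms is at most
    \<open>(n + 2) * q ^ n * u\<^sup>2\<close>; hence the constant 3.\<close>
  also have "\<dots> \<le> (real n + 2) * q ^ n * u\<^sup>2 + ((real n + 2) * q ^ n * u\<^sup>2 + (real n + 2) * q ^ n * u\<^sup>2)"
    using q_pos uu by (intro add_mono mult_mono) auto
  finally show ?thesis
    by (simp add: u_def power_divide mult_ac)
qed

section \<open>Summing the weights over n\<close>

lemma summable_inverse_q_quot: "summable (\<lambda>k. 1 / q_quot k)"
proof (rule summable_comparison_test')
  show "summable (\<lambda>k. q ^ k)"
    using q_pos q_less_1 by (simp add: summable_geometric)
  fix k :: nat assume "k \<ge> 1"
  then show "norm (1 / q_quot k) \<le> q ^ k"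
    using q_int_ge_1[of k] q_pos q_quot_pos[of k] by (simp add: q_quot_def field_simps mult_left_le)
qed

text \<open>For fixed \<open>k = m + Suc j\<close> the geometric series in \<open>n\<close> has sum
  \<open>q_quot m * (1 / q_quot (k - m) - 1 / q_quot k)\<close>, and the sum over \<open>j\<close>
  then telescopes. All terms are nonnegative, so the order of summation is free.\<close>

lemma sum_upper_weight:
  assumes "m > 0"
  shows "((\<lambda>n. upper_weight n m) has_sum (q_quot m * (\<Sum>k=1..m. 1 / q_quot k))) UNIV"
proof -
  define f where "f = (\<lambda>(j, n). (q_quot m / q_quot (m + Suc j)) ^ (n + 2) / q ^ (m + Suc j))"
  define g where "g = (\<lambda>j. q_quot m * (1 / q_quot (Suc j) - 1 / q_quot (m + Suc j)))"
  have f_nonneg: "f (j, n) \<ge> 0" for j n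
    using q_pos q_quot_pos[OF assms] q_quot_pos[of "m + Suc j"] by (auto simp: f_def)
  have inner: "((\<lambda>n. f (j, n)) has_sum g j) UNIV" for j
  proof -
    define x y z where "x = q_quot m" and "y = q_quot (m + Suc j)" and "z = q_quot (Suc j)"
    have pos: "x > 0" "y > 0" "z > 0"
      using assms q_quot_pos by (auto simp: x_def y_def z_def)
    have yx: "y = x + z / q ^ m"
      using q_quot_diff[of m "Suc j"] by (simp add: x_def y_def z_def)
    then have "x < y"
      using pos q_pos by simp
    have "norm (x / y) < 1"
      using pos \<open>x < y\<close> by simp
    from sums_divide[OF sums_mult[OF geometric_sums[OF this], of "(x / y)\<^sup>2"], of "q ^ (m + Suc j)"]
    have "(\<lambda>n. f (j, n)) sums ((x / y)\<^sup>2 * (1 / (1 - x / y)) / q ^ (m + Suc j))"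
      by (simp add: f_def x_def y_def power_add power2_eq_square mult_ac)
    also have "(x / y)\<^sup>2 * (1 / (1 - x / y)) = x * x / (y * (y - x))"
      using pos \<open>x < y\<close> by (simp add: power2_eq_square field_simps)
    also have "x * x / (y * (y - x)) / q ^ (m + Suc j) = x * (x / (y * z * q ^ Suc j))"
    proof -
      have "y - x = z / q ^ m"
        by (simp add: yx)
      then show ?thesis
        using pos q_pos by (simp only: power_add) (simp add: field_simps)
    qed
    \<comment> \<open>Partial fractions: \<open>q_quot_diff\<close> with the roles of
      \<open>m\<close> and \<open>Suc j\<close> exchanged gives
      \<open>y - z = x / q ^ Suc j\<close>.\<close>
    also have "x / (y * z * q ^ Suc j) = 1 / z - 1 / y"
    proof -
      have zy: "1 / z - 1 / y = (y - z) / (y * z)"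
        using pos by (simp add: field_simps)
      have "(y - z) * q ^ Suc j = x"
        using q_quot_diff[of "Suc j" m] q_pos by (simp add: x_def y_def z_def add.commute del: power_Suc)
      then show ?thesis
        unfolding zy using q_pos by (metis divide_divide_eq_left mult_divide_mult_cancel_right nonzero_mult_div_cancel_right power_not_zero less_irrefl)
    qed
    finally have "(\<lambda>n. f (j, n)) sums g j"
      by (simp add: g_def x_def y_def z_def)
    then show ?thesis
      using f_nonneg by (intro sums_nonneg_imp_has_sum)
  qed
  have "g sums (q_quot m * (\<Sum>k=1..m. 1 / q_quot k))"
    unfolding g_def by (intro sums_mult sums_diff_shift summable_inverse_q_quot)
  then have outer: "(g has_sum (q_quot m * (\<Sum>k=1..m. 1 / q_quot k))) UNIV"
    using has_sum_nonneg[OF inner] f_nonneg by (intro sums_nonneg_imp_has_sum) auto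
  have "f summable_on UNIV \<times> UNIV"
    using inner has_sum_imp_summable[OF outer] f_nonneg by (rule summable_on_SigmaI)
  with inner outer have "(f has_sum (q_quot m * (\<Sum>k=1..m. 1 / q_quot k))) (UNIV \<times> UNIV)"
    by (rule has_sum_SigmaI)
  then have "((\<lambda>(n, j). f (j, n)) has_sum (q_quot m * (\<Sum>k=1..m. 1 / q_quot k))) (UNIV \<times> UNIV)"
    by (subst has_sum_swap) (simp add: case_prod_unfold)
  then show ?thesis
    by (rule has_sum_SigmaD) (simp add: f_def upper_weight_has_sum[OF assms, simplified])
qed

text \<open>For fixed \<open>k\<close> the geometric series sums to
  \<open>q_quot m / q_quot (m - k)\<close>, because
  \<open>q_quot m - q_quot k = q_quot (m - k) / q ^ k\<close>; then \<open>k\<close> is reflected to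
  \<open>m - k\<close>.\<close>

lemma sum_lower_weight:
  assumes "m > 0"
  shows "(\<lambda>n. lower_weight n m) sums (q_quot m * (\<Sum>k\<in>{1..<m}. 1 / q_quot k))"
proof -
  have "(\<lambda>n. (q_quot k / q_quot m) ^ n / q ^ k) sums (q_quot m * (1 / q_quot (m - k)))" if k: "k \<in> {1..<m}" for k
  proof -
    define x y z where "x = q_quot k" and "y = q_quot m" and "z = q_quot (m - k)"
    have pos: "x > 0" "y > 0" "z > 0"
      using k q_quot_pos by (auto simp: x_def y_def z_def)
    have yx: "y = x + z / q ^ k"
      using q_quot_diff[of k "m - k"] k by (simp add: x_def y_def z_def)
    then have "x < y"
      using pos q_pos by simp
    then have "norm (x / y) < 1"
      using pos by simp
    from sums_divide[OF geometric_sums[OF this], of "q ^ k"]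
    have "(\<lambda>n. (x / y) ^ n / q ^ k) sums (1 / (1 - x / y) / q ^ k)" .
    also have "1 / (1 - x / y) = y / (y - x)"
      using pos \<open>x < y\<close> by (simp add: field_simps)
    also have "y / (y - x) / q ^ k = y * (1 / z)"
      using q_pos by (simp add: yx)
    finally show ?thesis
      by (simp add: x_def y_def z_def)
  qed
  then have "(\<lambda>n. lower_weight n m) sums (\<Sum>k\<in>{1..<m}. q_quot m * (1 / q_quot (m - k)))"
    unfolding lower_weight_def by (rule sums_sum)
  also have "(\<Sum>k\<in>{1..<m}. q_quot m * (1 / q_quot (m - k))) = (\<Sum>k\<in>{1..<m}. q_quot m * (1 / q_quot k))"
    by (rule sum.reindex_bij_witness[of _ "\<lambda>j. m - j" "\<lambda>j. m - j"]) auto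
  finally show ?thesis
    by (simp add: sum_distrib_left)
qed

text \<open>Of the two sums of reciprocals only the term \<open>k = m\<close> survives, and it
  contributes \<open>q_quot m / q_quot m\<close>.\<close>

lemma weight_diff_sums_1:
  assumes "m > 0"
  shows "(\<lambda>n. upper_weight n m - lower_weight n m) sums 1"
proof -
  have "{1..m} = insert m {1..<m}"
    using assms by auto
  then have "q_quot m * (\<Sum>k=1..m. 1 / q_quot k) - q_quot m * (\<Sum>k\<in>{1..<m}. 1 / q_quot k) = 1"
    using q_quot_pos[OF assms] by (simp add: algebra_simps)
  then show ?thesis
    using sums_diff[OF has_sum_imp_sums[OF sum_upper_weight[OF assms]] sum_lower_weight[OF assms]] by simp
qed

section \<open>Pairing the summands with the weights\<close>

lemma q_summand_pair_upper:
  assumes "m > 0" "k > 0"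
  shows "q_summand q (s - of_nat n - 2) m * q_summand q (of_nat n + 2) k =
    q_summand q s m * of_real ((q_quot m / q_quot k) ^ (n + 2) / q ^ k)"
proof -
  have "q_summand q s m = q_summand q (s - of_nat n - 2) m / of_real (q_quot m ^ (n + 2))"
    using q_summand_add_nat[OF assms(1), of "s - of_nat n - 2" "n + 2"] by (simp add: algebra_simps)
  then have "q_summand q (s - of_nat n - 2) m = q_summand q s m * of_real (q_quot m ^ (n + 2))"
    using q_quot_pos[OF assms(1)] by simp
  moreover have "q_summand q (of_nat n + 2) k = 1 / of_real (q ^ k) / of_real (q_quot k ^ (n + 2))"
    using q_summand_add_nat[OF assms(2), of 0 "n + 2"] q_summand_0[OF assms(2)] by (simp add: add.commute)
  ultimately show ?thesis
    by (simp add: power_divide)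
qed

lemma q_summand_pair_lower:
  assumes "m > 0" "k > 0"
  shows "q_summand q (- of_nat n) m * q_summand q (s + of_nat n) k =
    q_summand q s k * of_real ((q_quot m / q_quot k) ^ n / q ^ m)"
proof -
  have "q_summand q 0 m = q_summand q (- of_nat n) m / of_real (q_quot m ^ n)"
    using q_summand_add_nat[OF assms(1), of "- of_nat n" "n"] by simp
  then have "q_summand q (- of_nat n) m = of_real (q_quot m ^ n) / of_real (q ^ m)"
    using q_quot_pos[OF assms(1)] q_summand_0[OF assms(1)] by (simp add: field_simps)
  then show ?thesis
    using q_summand_add_nat[OF assms(2), of s n] by (simp add: power_divide mult_ac)
qed

text \<open>The smaller index stays outside, and the sum over the larger one is the weight. The two
  arguments add up to \<open>s\<close>, so \<open>Re s > 2\<close> gives absolute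
  convergence.\<close>

lemma zeta_q_series_upper:
  assumes "Re s > 2"
  shows "((\<lambda>i. q_summand q s (Suc i) * of_real (upper_weight n (Suc i))) has_sum
    zeta_q_series q [s - of_nat n - 2, of_nat n + 2]) UNIV"
proof (rule has_sum_SigmaD)
  have "(\<lambda>(i, j). q_summand q (s - of_nat n - 2) (Suc i) * q_summand q (of_nat n + 2) (Suc i + Suc j)) summable_on UNIV"
    using assms by (intro summable_on_q_summand_pair) auto
  then show "((\<lambda>(i, j). q_summand q (s - of_nat n - 2) (Suc i) * q_summand q (of_nat n + 2) (Suc i + Suc j)) has_sum
      zeta_q_series q [s - of_nat n - 2, of_nat n + 2]) (UNIV \<times> UNIV)"
    unfolding zeta_q_series_pair by (simp add: has_sum_infsum)
  fix i :: nat
  have "((\<lambda>j. q_summand q s (Suc i) * of_real ((q_quot (Suc i) / q_quot (Suc i + Suc j)) ^ (n + 2) / q ^ (Suc i + Suc j)))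
      has_sum q_summand q s (Suc i) * of_real (upper_weight n (Suc i))) UNIV"
    by (intro has_sum_cmult_right has_sum_of_real upper_weight_has_sum) simp
  then show "((\<lambda>j. case (i, j) of (i, j) \<Rightarrow>
      q_summand q (s - of_nat n - 2) (Suc i) * q_summand q (of_nat n + 2) (Suc i + Suc j)) has_sum
      q_summand q s (Suc i) * of_real (upper_weight n (Suc i))) UNIV"
    by (simp only: prod.case q_summand_pair_upper zero_less_Suc add_pos_pos)
qed

text \<open>Here the larger index stays outside, so the inner sums are finite.\<close>

lemma zeta_q_series_lower:
  assumes "Re s > 2"
  shows "((\<lambda>k. q_summand q s (Suc k) * of_real (lower_weight n (Suc k))) has_sum
    zeta_q_series q [- of_nat n, s + of_nat n]) UNIV"
proof (rule has_sum_SigmaD)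
  let ?f = "\<lambda>(i, j). q_summand q (- of_nat n) (Suc i) * q_summand q (s + of_nat n) (Suc i + Suc j)"
  let ?g = "\<lambda>(k, i). q_summand q (- of_nat n) (Suc i) * q_summand q (s + of_nat n) (Suc k)"
  have "?f summable_on UNIV"
    using assms by (intro summable_on_q_summand_pair) auto
  then have "(?f has_sum zeta_q_series q [- of_nat n, s + of_nat n]) UNIV"
    unfolding zeta_q_series_pair by (simp add: has_sum_infsum)
  \<comment> \<open>The larger index becomes \<open>Suc k\<close> with \<open>k = i + Suc j\<close>,
    which turns the free pairs into the triangle \<open>i < k\<close>.\<close>
  also have "?this \<longleftrightarrow> (?g has_sum zeta_q_series q [- of_nat n, s + of_nat n]) (SIGMA k:UNIV. {..<k})"
    by (rule has_sum_reindex_bij_witness[of _ "\<lambda>(k, i). (i, k - Suc i)" "\<lambda>(i, j). (i + Suc j, i)"]) auto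
  finally show "(?g has_sum zeta_q_series q [- of_nat n, s + of_nat n]) (SIGMA k:UNIV. {..<k})" .
  fix k :: nat
  have "(\<Sum>i<k. q_summand q (- of_nat n) (Suc i) * q_summand q (s + of_nat n) (Suc k)) =
      (\<Sum>i<k. q_summand q s (Suc k) * of_real ((q_quot (Suc i) / q_quot (Suc k)) ^ n / q ^ Suc i))"
    by (intro sum.cong refl q_summand_pair_lower) auto
  also have "\<dots> = q_summand q s (Suc k) * of_real (\<Sum>i<k. (q_quot (Suc i) / q_quot (Suc k)) ^ n / q ^ Suc i)"
    by (simp only: sum_distrib_left of_real_sum)
  also have "(\<Sum>i<k. (q_quot (Suc i) / q_quot (Suc k)) ^ n / q ^ Suc i) = lower_weight n (Suc k)"
    unfolding lower_weight_def by (rule sum.reindex_bij_witness[of _ "\<lambda>i. i - 1" Suc]) auto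
  finally show "((\<lambda>i. ?g (k, i)) has_sum q_summand q s (Suc k) * of_real (lower_weight n (Suc k))) {..<k}"
    by (simp add: has_sum_finite_iff)
qed

section \<open>The difference of the zeta values as a single sum\<close>

text \<open>The weights are subtracted before summation: their leading terms cancel, which gives
  convergence for \<open>Re s > 1\<close>.\<close>

definition zeta_diff :: "nat \<Rightarrow> complex \<Rightarrow> complex" where
  "zeta_diff n s = (\<Sum>\<^sub>\<infinity>i. q_summand q s (Suc i) * of_real (upper_weight n (Suc i) - lower_weight n (Suc i)))"

lemma zeta_q_series_diff:
  assumes "Re s > 2"
  shows "zeta_q_series q [s - of_nat n - 2, of_nat n + 2] - zeta_q_series q [- of_nat n, s + of_nat n] = zeta_diff n s"
  using has_sum_add[OF zeta_q_series_upper[OF assms, of n] has_sum_uminusI[OF zeta_q_series_lower[OF assms, of n]]]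
  by (simp add: zeta_diff_def right_diff_distrib infsumI)

lemma norm_q_summand_le_geometric:
  assumes "0 \<le> c" "c \<le> Re s" "m > 0"
  shows "norm (q_summand q s m) \<le> (q powr (c - 1)) ^ m"
proof -
  have "q powr (Re s - 1) \<le> q powr (c - 1)"
    using assms q_pos q_less_1 by (intro powr_mono') auto
  then have "(q powr (Re s - 1)) ^ m / q_int q m powr Re s \<le> (q powr (c - 1)) ^ m / 1"
    using assms q_int_ge_1[OF assms(3)] by (intro frac_le power_mono ge_one_powr_ge_zero) auto
  then show ?thesis
    by (simp add: norm_q_summand[OF assms(3)])
qed

lemma norm_zeta_diff_term:
  assumes "0 \<le> c" "c \<le> Re s"
  shows "norm (q_summand q s (Suc i) * of_real (upper_weight n (Suc i) - lower_weight n (Suc i)))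
    \<le> 3 / (1 - q)\<^sup>2 * ((real n + 2) * q ^ n) * (q powr (c - 1)) ^ Suc i"
proof -
  have "norm (q_summand q s (Suc i) * of_real (upper_weight n (Suc i) - lower_weight n (Suc i))) =
      \<bar>upper_weight n (Suc i) - lower_weight n (Suc i)\<bar> * norm (q_summand q s (Suc i))"
    by (simp add: norm_mult flip: of_real_diff)
  also have "\<dots> \<le> 3 / (1 - q)\<^sup>2 * ((real n + 2) * q ^ n) * (q powr (c - 1)) ^ Suc i"
    using q_pos by (intro mult_mono weight_diff_le norm_q_summand_le_geometric assms) auto
  finally show ?thesis .
qed

lemma summable_on_q_powr:
  assumes "c > 1"
  shows "(\<lambda>i. (q powr (c - 1)) ^ Suc i) summable_on UNIV"
  using assms q_pos q_less_1 summable_on_cmult_right[OF summable_on_geometric[of "q powr (c - 1)"], of "q powr (c - 1)"]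
  by (simp add: powr01_less_one)

lemma zeta_diff_holomorphic: "zeta_diff n holomorphic_on {s. Re s > 1}"
  unfolding zeta_diff_def
proof (rule holomorphic_on_infsum_compact)
  show "open {s. 1 < Re s}"
    by (simp add: open_halfspace_Re_gt)
  show "(\<lambda>s. q_summand q s (Suc i) * of_real (upper_weight n (Suc i) - lower_weight n (Suc i))) holomorphic_on {s. 1 < Re s}" for i
    unfolding q_summand_def using q_pos q_int_pos[of "Suc i"] by (intro holomorphic_intros) auto
  fix K :: "complex set"
  assume K: "compact K" "K \<subseteq> {s. 1 < Re s}"
  show "\<exists>M. M summable_on UNIV \<and> (\<forall>i\<in>UNIV. \<forall>s\<in>K.
      norm (q_summand q s (Suc i) * of_real (upper_weight n (Suc i) - lower_weight n (Suc i))) \<le> M i)"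
  proof (cases "K = {}")
    case True
    then show ?thesis
      by (intro exI[of _ "\<lambda>_. 0"]) auto
  next
    case False
    \<comment> \<open>The least real part on \<open>K\<close> exceeds 1 and yields one geometric
      majorant for all of \<open>K\<close>.\<close>
    obtain s0 where s0: "s0 \<in> K" "\<And>s. s \<in> K \<Longrightarrow> Re s0 \<le> Re s"
      using continuous_attains_inf[OF K(1) False, of Re] continuous_on_Re[OF continuous_on_id] by auto
    have "Re s0 > 1"
      using K(2) s0(1) by auto
    then show ?thesis
      using s0(2) by (intro exI[of _ "\<lambda>i. 3 / (1 - q)\<^sup>2 * ((real n + 2) * q ^ n) * (q powr (Re s0 - 1)) ^ Suc i"]
        conjI ballI norm_zeta_diff_term summable_on_cmult_right summable_on_q_powr) auto
  qed
qed

text \<open>The majorant is a summable sequence in \<open>n\<close> times a geometric one in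
  \<open>i\<close>, so the sums may be exchanged; for each \<open>i\<close> the weight differences
  then add up to 1.\<close>

lemma zeta_diff_sums:
  assumes "Re s > 1"
  shows "(\<lambda>n. zeta_diff n s) sums zeta_q_series q [s]"
proof -
  define f where "f = (\<lambda>(n, i). q_summand q s (Suc i) * of_real (upper_weight n (Suc i) - lower_weight n (Suc i)))"
  define C where "C = 3 / (1 - q)\<^sup>2"
  define u where "u = (\<lambda>n. C * ((real n + 2) * q ^ n))"
  have u_nonneg: "u n \<ge> 0" for n
    using q_pos by (auto simp: u_def C_def)
  \<comment> \<open>Differentiating the geometric series gives the summability of
    \<open>(n + 1) * q ^ n\<close>.\<close>
  have "summable (\<lambda>n. diffs (\<lambda>_. 1) n * q ^ n)"
    using q_pos q_less_1 by (intro termdiff_converges[of q 1]) (auto simp: summable_geometric)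
  then have "summable (\<lambda>n. C * (real (Suc n) * q ^ n + q ^ n))"
    using q_pos q_less_1 by (intro summable_mult summable_add) (auto simp: diffs_def summable_geometric)
  then have "summable u"
    by (simp add: u_def algebra_simps)
  then have "u summable_on UNIV"
    using u_nonneg by (intro norm_summable_imp_summable_on) simp
  from summable_on_Times_mult[OF this summable_on_q_powr[OF assms] u_nonneg]
  have bound: "(\<lambda>(n, i). u n * (q powr (Re s - 1)) ^ Suc i) summable_on UNIV \<times> UNIV"
    by simp
  have "(\<lambda>p. norm (f p)) summable_on UNIV \<times> UNIV"
    using bound
  proof (rule Infinite_Sum.abs_summable_on_comparison_test')
    show "norm (f p) \<le> (case p of (n, i) \<Rightarrow> u n * (q powr (Re s - 1)) ^ Suc i)" for p
      using norm_zeta_diff_term[of "Re s" s] assms by (simp add: f_def u_def C_def case_prod_unfold)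
  qed
  then have f: "f summable_on UNIV \<times> UNIV"
    by (rule abs_summable_summable)
  then have f': "(\<lambda>(i, n). f (n, i)) summable_on UNIV \<times> UNIV"
    by (subst summable_on_swap) (simp add: case_prod_unfold)
  have "(\<Sum>\<^sub>\<infinity>n. f (n, i)) = q_summand q s (Suc i)" for i
  proof (rule infsumI)
    have "summable (\<lambda>n. norm (upper_weight n (Suc i) - lower_weight n (Suc i)))"
    proof (rule summable_comparison_test'[OF \<open>summable u\<close>])
      show "norm (norm (upper_weight n (Suc i) - lower_weight n (Suc i))) \<le> u n" for n
        using weight_diff_le[of "Suc i" n] by (simp add: u_def C_def)
    qed
    then have "((\<lambda>n. upper_weight n (Suc i) - lower_weight n (Suc i)) has_sum 1) UNIV"
      by (rule norm_summable_imp_has_sum) (simp add: weight_diff_sums_1)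
    from has_sum_cmult_right[OF has_sum_of_real[OF this], of "q_summand q s (Suc i)"]
    show "((\<lambda>n. f (n, i)) has_sum q_summand q s (Suc i)) UNIV"
      by (simp add: f_def)
  qed
  then have "infsum (\<lambda>(i, n). f (n, i)) (UNIV \<times> UNIV) = zeta_q_series q [s]"
    using infsum_Sigma_banach[OF f'] by (simp add: zeta_q_series_single)
  then have "((\<lambda>(i, n). f (n, i)) has_sum zeta_q_series q [s]) (UNIV \<times> UNIV)"
    using has_sum_infsum[OF f'] by simp
  then have "(f has_sum zeta_q_series q [s]) (UNIV \<times> UNIV)"
    by (subst has_sum_swap) (simp add: case_prod_unfold)
  moreover have "((\<lambda>i. f (n, i)) has_sum zeta_diff n s) UNIV" for n
    using summable_on_SigmaD1[of "\<lambda>n i. f (n, i)" UNIV "\<lambda>_. UNIV" n] f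
    by (simp add: has_sum_infsum f_def zeta_diff_def)
  ultimately have "((\<lambda>n. zeta_diff n s) has_sum zeta_q_series q [s]) UNIV"
    by (rule has_sum_SigmaD)
  then show ?thesis
    by (rule has_sum_imp_sums)
qed

section \<open>Continuation of the double zeta function\<close>

lemma q_powr_add_nat: "complex_of_real q powr (w + of_nat l) = of_real q powr w * of_real (q ^ l)"
  using q_pos by (simp add: powr_add powr_nat')

lemma q_powr_eq_1_iff: "complex_of_real q powr w = 1 \<longleftrightarrow> (\<exists>m::int. w = of_int m * q_period q)"
proof -
  have ln: "complex_of_real (ln q) \<noteq> 0"
    using q_pos q_less_1 by simp
  have "complex_of_real q powr w = 1 \<longleftrightarrow> exp (w * of_real (ln q)) = exp 0"
    by (simp add: of_real_q_powr)
  also have "\<dots> \<longleftrightarrow> (\<exists>m::int. w * of_real (ln q) = of_int (2 * m) * pi * \<i>)"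
    by (simp only: exp_eq) simp
  also have "\<dots> \<longleftrightarrow> (\<exists>m::int. w = of_int m * q_period q)"
    using ln by (simp add: q_period_def field_simps)
  finally show ?thesis .
qed

lemma Re_q_period [simp]: "Re (q_period q) = 0"
  by (simp add: q_period_def Re_divide_of_real)

lemma q_period_nonzero: "q_period q \<noteq> 0"
  using q_pos q_less_1 by (simp add: q_period_def)

section \<open>The singular set for two variables\<close>

text \<open>The period is purely imaginary, so distinct lattice points differ by at least 1 in the
  real part or by at least \<open>p\<close> in the imaginary part; uniformly separated sets are
  closed.\<close>

lemma closed_lattice_subset:
  assumes "S \<subseteq> {of_int k + of_int m * q_period q | k m :: int. True}"
  shows "closed S"
proof (rule discrete_imp_closed)
  define p where "p = \<bar>Im (q_period q)\<bar>"
  have p: "p > 0"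
    using q_period_nonzero by (auto simp: p_def complex_eq_iff)
  then show "min 1 p > 0" by simp
  show "\<forall>x\<in>S. \<forall>y\<in>S. dist y x < min 1 p \<longrightarrow> y = x"
  proof (intro ballI impI)
    fix x y assume xy: "x \<in> S" "y \<in> S" "dist y x < min 1 p"
    then obtain k m k' m' :: int where eq: "x = of_int k + of_int m * q_period q" "y = of_int k' + of_int m' * q_period q"
      using assms by blast
    have "\<bar>Re (y - x)\<bar> < 1" "\<bar>Im (y - x)\<bar> < p"
      using xy(3) abs_Re_le_cmod[of "y - x"] abs_Im_le_cmod[of "y - x"] by (auto simp: dist_norm)
    moreover have "\<bar>Re (y - x)\<bar> = \<bar>of_int (k' - k)\<bar>"
      by (simp add: eq)
    moreover have "\<bar>Im (y - x)\<bar> = \<bar>of_int (m' - m)\<bar> * p"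
      by (simp add: eq p_def flip: abs_mult left_diff_distrib)
    ultimately have "\<bar>real_of_int (k' - k)\<bar> < 1" "\<bar>real_of_int (m' - m)\<bar> < 1"
      using p by auto
    then have "k' = k" "m' = m"
      by linarith+
    then show "y = x"
      by (simp add: eq)
  qed
qed

text \<open>For two variables the singular set splits into a condition on the last entry
  \<open>b\<close> and one on \<open>a + b\<close>. The latter comes from \<open>j = 1\<close>,
  where the bound \<open>r - j + 1\<close> is 2.\<close>

definition last_regular :: "complex set" where
  "last_regular = - {b. (\<exists>m::int. b = 1 + of_int m * q_period q) \<or>
     (\<exists>k m::int. k \<le> 0 \<and> m \<noteq> 0 \<and> b = of_int k + of_int m * q_period q)}"

definition sum_regular :: "complex set" where
  "sum_regular = - {w. \<exists>k m::int. k \<le> 2 \<and> w = of_int k + of_int m * q_period q}"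

lemma pair_notin_sing: "[a, b] \<notin> zeta_q_sing q 2 \<longleftrightarrow> b \<in> last_regular \<and> a + b \<in> sum_regular"
proof -
  have "{1..<2} = {1::nat}" by auto
  then show ?thesis
    by (auto simp: zeta_q_sing_def last_regular_def sum_regular_def)
qed

lemma open_last_regular: "open last_regular"
  unfolding last_regular_def
proof (intro open_Compl closed_lattice_subset subsetI)
  fix b
  assume "b \<in> {b. (\<exists>m::int. b = 1 + of_int m * q_period q) \<or>
     (\<exists>k m::int. k \<le> 0 \<and> m \<noteq> 0 \<and> b = of_int k + of_int m * q_period q)}"
  then show "b \<in> {of_int k + of_int m * q_period q | k m :: int. True}"
    by (auto intro: exI[of _ "1::int"])
qed

lemma open_sum_regular: "open sum_regular"
  unfolding sum_regular_def by (intro open_Compl closed_lattice_subset) auto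

section \<open>Geometric factors and the removal of their poles at nonpositive integers\<close>

text \<open>The sum of \<open>(q powr w) ^ m\<close> over \<open>m \<ge> 1\<close> when
  \<open>Re w > 0\<close>, and its meromorphic continuation elsewhere.\<close>

definition q_geom :: "complex \<Rightarrow> complex" where
  "q_geom w = of_real q powr w / (1 - of_real q powr w)"

text \<open>The value at 0 is the limit. Dividing by this function instead of
  \<open>1 - q powr w\<close> removes the pole at \<open>w = 0\<close> and keeps those at the
  nonzero multiples of the period.\<close>

definition q_quotient_ext :: "complex \<Rightarrow> complex" where
  "q_quotient_ext w = (if w = 0 then - of_real (ln q) else (1 - of_real q powr w) / w)"

lemma q_quotient_ext_holomorphic: "q_quotient_ext holomorphic_on UNIV"
proof -
  \<comment> \<open>Chosen so that \<open>q_quotient_ext\<close> is the difference quotient of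
    \<open>g\<close> at 0, a removable singularity.\<close>
  define g :: "complex \<Rightarrow> complex" where "g = (\<lambda>w. - (of_real q powr w))"
  have "g holomorphic_on UNIV"
    unfolding g_def using q_pos by (intro holomorphic_intros) auto
  then have "(\<lambda>z. if z = 0 then deriv g 0 else (g z - g 0) / (z - 0)) holomorphic_on UNIV"
    by (rule pole_lemma) simp
  moreover have "(g has_field_derivative - of_real (ln q)) (at 0)"
    unfolding g_def using q_pos by (auto intro!: derivative_eq_intros simp: Ln_of_real)
  then have "deriv g 0 = - of_real (ln q)"
    by (rule DERIV_imp_deriv)
  moreover have "g 0 = -1"
    using q_pos by (simp add: g_def)
  ultimately have "(\<lambda>z. if z = 0 then - of_real (ln q) else (g z - (- 1)) / (z - 0)) holomorphic_on UNIV"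
    by (simp only:)
  moreover have "q_quotient_ext = (\<lambda>z. if z = 0 then - of_real (ln q) else (g z - (- 1)) / (z - 0))"
    by (simp add: q_quotient_ext_def g_def fun_eq_iff)
  ultimately show ?thesis
    by (simp only:)
qed

lemma q_quotient_ext_nonzero:
  assumes "\<And>m::int. m \<noteq> 0 \<Longrightarrow> w \<noteq> of_int m * q_period q"
  shows "q_quotient_ext w \<noteq> 0"
proof (cases "w = 0")
  case True
  then show ?thesis
    using q_pos q_less_1 by (simp add: q_quotient_ext_def)
next
  case False
  then have "of_real q powr w \<noteq> (1::complex)"
    unfolding q_powr_eq_1_iff using assms by (metis mult_zero_left of_int_0)
  then show ?thesis
    using False by (simp add: q_quotient_ext_def)
qed

text \<open>The holomorphic extension of \<open>neg_binom b l * q_geom (b - 1 + l)\<close> through \<open>b = 1 - l\<close>, \<open>l > 0\<close>,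
  where the factor \<open>b + l - 1\<close> of the Pochhammer symbol cancels the pole of \<open>q_geom\<close>.\<close>

definition reg_coeff :: "complex \<Rightarrow> nat \<Rightarrow> complex" where
  "reg_coeff b l = (case l of 0 \<Rightarrow> q_geom (b - 1)
     | Suc k \<Rightarrow> pochhammer b k / fact (Suc k) * of_real q powr (b + of_nat k) / q_quotient_ext (b + of_nat k))"

text \<open>Off the poles \<open>b + of_nat k\<close> is nonzero, since \<open>q powr 0 = 1\<close>,
  and the last Pochhammer factor can be put back.\<close>

lemma reg_coeff_eq:
  assumes "of_real q powr (b - 1 + of_nat l) \<noteq> (1::complex)"
  shows "reg_coeff b l = neg_binom b l * q_geom (b - 1 + of_nat l)"
proof (cases l)
  case 0
  then show ?thesis
    by (simp add: reg_coeff_def neg_binom_def)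
next
  case (Suc k)
  then have w: "b - 1 + of_nat l = b + of_nat k"
    by simp
  have "b + of_nat k \<noteq> 0"
    using assms q_pos unfolding w by auto
  then show ?thesis
    unfolding w by (simp add: Suc reg_coeff_def neg_binom_def q_geom_def q_quotient_ext_def pochhammer_Suc)
qed

lemma q_geom_holomorphic [holomorphic_intros]:
  assumes "f holomorphic_on S" "\<And>z. z \<in> S \<Longrightarrow> of_real q powr (f z) \<noteq> (1::complex)"
  shows "(\<lambda>z. q_geom (f z)) holomorphic_on S"
  unfolding q_geom_def using assms q_pos by (intro holomorphic_intros) auto

text \<open>The remaining poles are 1 plus multiples of the period for \<open>l = 0\<close>, and
  \<open>- k\<close> plus nonzero multiples for \<open>l = Suc k\<close>: the two families excluded
  from \<open>last_regular\<close>.\<close>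

lemma reg_coeff_holomorphic: "(\<lambda>b. reg_coeff b l) holomorphic_on last_regular"
proof (cases l)
  case 0
  have "of_real q powr (b - 1) \<noteq> (1::complex)" if "b \<in> last_regular" for b
    using that unfolding q_powr_eq_1_iff last_regular_def by (auto simp: algebra_simps)
  then show ?thesis
    by (auto simp: 0 reg_coeff_def intro!: holomorphic_intros)
next
  case (Suc k)
  have "q_quotient_ext (b + of_nat k) \<noteq> 0" if b: "b \<in> last_regular" for b
  proof (rule q_quotient_ext_nonzero)
    fix m :: int assume "m \<noteq> 0"
    moreover have "- int k \<le> 0" by simp
    ultimately have "b \<noteq> of_int (- int k) + of_int m * q_period q"
      using b unfolding last_regular_def by blast
    then show "b + of_nat k \<noteq> of_int m * q_period q"
      by (auto simp: algebra_simps)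
  qed
  moreover have "(\<lambda>b. q_quotient_ext (b + of_nat k)) holomorphic_on last_regular"
    by (rule holomorphic_on_compose_gen[OF _ q_quotient_ext_holomorphic, unfolded o_def]) (auto intro: holomorphic_intros)
  ultimately show ?thesis
    using q_pos by (auto simp: Suc reg_coeff_def simp del: fact_Suc intro!: holomorphic_intros)
qed

lemma sum_regular_q_powr:
  assumes "w \<in> sum_regular"
  shows "of_real q powr (w - 2 + of_nat l) \<noteq> (1::complex)"
proof
  assume "of_real q powr (w - 2 + of_nat l) = (1::complex)"
  then obtain m :: int where "w = of_int (2 - int l) + of_int m * q_period q"
    unfolding q_powr_eq_1_iff by (auto simp: algebra_simps)
  moreover have "2 - int l \<le> 2" by simp
  ultimately show False
    using assms unfolding sum_regular_def by blast
qed

text \<open>With \<open>B\<close> bounding \<open>norm (q powr w)\<close> on \<open>W\<close>, the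
  shifted power is at most \<open>1 / 2\<close> once \<open>q ^ l < 1 / (2 * B)\<close>. The
  denominator is then at least \<open>1 / 2\<close>, which rules out poles and gives the constant
  \<open>2 * B\<close>.\<close>

lemma q_geom_tail:
  assumes "bounded W"
  obtains C L where "\<And>l w. l \<ge> L \<Longrightarrow> w \<in> W \<Longrightarrow> of_real q powr (w + of_nat l) \<noteq> (1::complex)"
    "\<And>l w. l \<ge> L \<Longrightarrow> w \<in> W \<Longrightarrow> norm (q_geom (w + of_nat l)) \<le> C * q ^ l"
proof -
  obtain r where r: "\<And>w. w \<in> W \<Longrightarrow> norm w \<le> r"
    using assms by (auto simp: bounded_iff)
  define B where "B = q powr (- r)"
  have B: "B > 0"
    using q_pos by (simp add: B_def)
  have "(\<lambda>n. q ^ n) \<longlonglongrightarrow> 0"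
    using q_pos q_less_1 by (intro LIMSEQ_power_zero) auto
  then have "eventually (\<lambda>n. q ^ n < 1 / (2 * B)) sequentially"
    using B by (intro order_tendstoD) auto
  then obtain L where L: "\<And>l. l \<ge> L \<Longrightarrow> q ^ l < 1 / (2 * B)"
    by (auto simp: eventually_sequentially)
  have le: "norm (of_real q powr (w + of_nat l) :: complex) \<le> B * q ^ l" if "w \<in> W" for w l
  proof -
    have "q powr Re w \<le> B"
      unfolding B_def using q_pos q_less_1 r[OF that] abs_Re_le_cmod[of w] by (intro powr_mono') auto
    then show ?thesis
      using q_pos by (simp add: q_powr_add_nat norm_mult norm_q_powr norm_power mult_right_mono)
  qed
  have half: "norm (of_real q powr (w + of_nat l) :: complex) \<le> 1 / 2" if "l \<ge> L" "w \<in> W" for w l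
    using le[OF that(2), of l] L[OF that(1)] B by (simp add: field_simps)
  show ?thesis
  proof
    show "of_real q powr (w + of_nat l) \<noteq> (1::complex)" if "l \<ge> L" "w \<in> W" for l w
      using half[OF that] by auto
    show "norm (q_geom (w + of_nat l)) \<le> 2 * B * q ^ l" if "l \<ge> L" "w \<in> W" for l w
    proof -
      define z :: complex where "z = of_real q powr (w + of_nat l)"
      have "norm (1 - z) \<ge> 1 / 2"
        using half[OF that] norm_triangle_ineq2[of 1 z] by (simp add: z_def)
      then have "norm z / norm (1 - z) \<le> B * q ^ l / (1 / 2)"
        using le[OF that(2), of l] B q_pos by (intro frac_le) (auto simp: z_def)
      then show ?thesis
        by (simp add: q_geom_def norm_divide flip: z_def)
    qed
  qed
qed

section \<open>The continued double series\<close>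

text \<open>What a pair of binomial terms contributes after the geometric sums over \<open>m\<close>
  and \<open>k - m\<close>, without the common factor \<open>(1 - q) powr (a + b)\<close>. The
  coefficient in \<open>b\<close> is taken in its regularised form.\<close>

definition cont_term :: "nat \<times> nat \<Rightarrow> complex \<times> complex \<Rightarrow> complex" where
  "cont_term = (\<lambda>(l, l') (a, b). neg_binom a l * reg_coeff b l' * q_geom (a + b - 2 + of_nat (l + l')))"

definition cont_sum :: "complex \<times> complex \<Rightarrow> complex" where
  "cont_sum p = (\<Sum>\<^sub>\<infinity>i. cont_term i p)"

definition regular_pairs :: "(complex \<times> complex) set" where
  "regular_pairs = {(a, b). b \<in> last_regular \<and> a + b \<in> sum_regular}"

lemma open_regular_pairs: "open regular_pairs"
proof -
  have "regular_pairs = snd -` last_regular \<inter> (\<lambda>p. fst p + snd p) -` sum_regular"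
    by (auto simp: regular_pairs_def)
  then show ?thesis
    by (auto intro!: open_vimage open_last_regular open_sum_regular continuous_intros)
qed

lemma cont_term_continuous: "continuous_on regular_pairs (cont_term i)"
proof -
  obtain l l' where i: "i = (l, l')" by (cases i)
  have "continuous_on regular_pairs (\<lambda>p. neg_binom (fst p) l)"
    unfolding neg_binom_def pochhammer_prod by (intro continuous_intros) auto
  moreover have "continuous_on regular_pairs (\<lambda>p. reg_coeff (snd p) l')"
    by (rule continuous_on_compose2[OF holomorphic_on_imp_continuous_on[OF reg_coeff_holomorphic]])
       (auto simp: regular_pairs_def intro: continuous_intros)
  moreover have "(\<lambda>w. q_geom (w - 2 + of_nat (l + l'))) holomorphic_on sum_regular"
    by (intro holomorphic_intros sum_regular_q_powr)
  then have "continuous_on regular_pairs (\<lambda>p. q_geom (fst p + snd p - 2 + of_nat (l + l')))"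
    by (rule continuous_on_compose2[OF holomorphic_on_imp_continuous_on])
       (auto simp: regular_pairs_def intro!: continuous_intros)
  ultimately show ?thesis
    unfolding i cont_term_def by (simp add: case_prod_unfold continuous_on_mult)
qed

text \<open>With \<open>R\<close> bounding both coordinates on \<open>K\<close>, the factors are
  dominated by \<open>neg_binom R l\<close> and by multiples of
  \<open>neg_binom R l' * q ^ l'\<close> and \<open>q ^ (l + l')\<close>; the binomial series at
  \<open>q < 1\<close> makes the product summable.\<close>

lemma cont_term_bound:
  assumes K: "compact K" "K \<subseteq> regular_pairs"
  shows "\<exists>M. M summable_on UNIV \<and> (\<forall>i\<in>UNIV. \<forall>p\<in>K. norm (cont_term i p) \<le> M i)"
proof -
  have compact_img: "compact (fst ` K)" "compact (snd ` K)" "compact ((\<lambda>p. fst p + snd p) ` K)"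
    by (auto intro!: compact_continuous_image[OF _ K(1)] continuous_intros)
  have "bounded (fst ` K \<union> snd ` K)"
    using compact_img compact_imp_bounded by blast
  then obtain R where R: "R > 0" "\<And>x. x \<in> fst ` K \<union> snd ` K \<Longrightarrow> norm x \<le> R"
    by (meson bounded_pos)
  have last: "snd ` K \<subseteq> last_regular" and sum: "(\<lambda>p. fst p + snd p) ` K \<subseteq> sum_regular"
    using K(2) by (auto simp: regular_pairs_def)
  have binom_pos: "neg_binom R l > 0" for l
    using R(1) by (simp add: neg_binom_def pochhammer_pos)
  obtain C1 where C1: "\<And>l b. b \<in> snd ` K \<Longrightarrow> norm (reg_coeff b l) \<le> C1 * (neg_binom R l * q ^ l)"
  proof -
    have "bounded ((\<lambda>b. b - 1) ` snd ` K)"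
      by (rule compact_imp_bounded[OF compact_continuous_image[OF _ compact_img(2)]]) (intro continuous_intros)
    then obtain C L where tail: "\<And>l w. l \<ge> L \<Longrightarrow> w \<in> (\<lambda>b. b - 1) ` snd ` K \<Longrightarrow> of_real q powr (w + of_nat l) \<noteq> (1::complex)"
      "\<And>l w. l \<ge> L \<Longrightarrow> w \<in> (\<lambda>b. b - 1) ` snd ` K \<Longrightarrow> norm (q_geom (w + of_nat l)) \<le> C * q ^ l"
      by (rule q_geom_tail) blast
    \<comment> \<open>For large \<open>l\<close> no pole is met on \<open>K\<close>, so the
      coefficient is the plain product with \<open>q_geom\<close>; the finitely many others are
      bounded by continuity.\<close>
    have le: "norm (reg_coeff b l) \<le> C * (neg_binom R l * q ^ l)" if "l \<ge> L" "b \<in> snd ` K" for l b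
    proof -
      have "norm (reg_coeff b l) = norm (neg_binom b l) * norm (q_geom (b - 1 + of_nat l))"
        using tail(1)[OF that(1), of "b - 1"] that(2) by (subst reg_coeff_eq) (auto simp: norm_mult)
      also have "\<dots> \<le> neg_binom R l * (C * q ^ l)"
        using R that tail(2)[OF that(1), of "b - 1"] binom_pos[of l]
        by (intro mult_mono norm_neg_binom_le) auto
      finally show ?thesis by (simp add: mult_ac)
    qed
    have cont: "continuous_on (snd ` K) (\<lambda>b. reg_coeff b l)" for l
      using holomorphic_on_imp_continuous_on[OF reg_coeff_holomorphic] last by (rule continuous_on_subset)
    have pos: "neg_binom R l * q ^ l > 0" for l
      using binom_pos q_pos by simp
    show ?thesis
      by (rule uniform_bound_from_tail[where f = "\<lambda>l b. reg_coeff b l" and L = L, OF compact_img(2) cont pos le]) (assumption | rule that)+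
  qed
  obtain C2 where C2: "\<And>l w. w \<in> (\<lambda>p. fst p + snd p) ` K \<Longrightarrow> norm (q_geom (w - 2 + of_nat l)) \<le> C2 * q ^ l"
  proof -
    have "bounded ((\<lambda>b. b - 2) ` (\<lambda>p. fst p + snd p) ` K)"
      by (rule compact_imp_bounded[OF compact_continuous_image[OF _ compact_img(3)]]) (intro continuous_intros)
    then obtain C L where tail: "\<And>l w. l \<ge> L \<Longrightarrow> w \<in> (\<lambda>b. b - 2) ` (\<lambda>p. fst p + snd p) ` K \<Longrightarrow> norm (q_geom (w + of_nat l)) \<le> C * q ^ l"
      by (rule q_geom_tail) blast
    have le: "norm (q_geom (w - 2 + of_nat l)) \<le> C * q ^ l" if "l \<ge> L" "w \<in> (\<lambda>p. fst p + snd p) ` K" for l w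
      using that by (intro tail) auto
    have "(\<lambda>w. q_geom (w - 2 + of_nat l)) holomorphic_on (\<lambda>p. fst p + snd p) ` K" for l
      using sum by (intro holomorphic_intros sum_regular_q_powr) auto
    then have cont: "continuous_on ((\<lambda>p. fst p + snd p) ` K) (\<lambda>w. q_geom (w - 2 + of_nat l))" for l
      by (rule holomorphic_on_imp_continuous_on)
    have pos: "q ^ l > 0" for l
      using q_pos by simp
    show ?thesis
      by (rule uniform_bound_from_tail[where f = "\<lambda>l w. q_geom (w - 2 + of_nat l)" and L = L, OF compact_img(3) cont pos le]) (assumption | rule that)+
  qed
  define M where "M = (\<lambda>(l, l'). \<bar>C1 * C2\<bar> * ((neg_binom R l * q ^ l) * (neg_binom R l' * q ^ l')))"
  have "(\<lambda>(l, l'). (neg_binom R l * q ^ l) * (neg_binom R l' * q ^ l')) summable_on UNIV \<times> UNIV"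
    using q_pos q_less_1 R(1) binom_pos
    by (intro summable_on_Times_mult neg_binom_summable) (auto simp: less_imp_le)
  from summable_on_cmult_right[OF this, of "\<bar>C1 * C2\<bar>"] have "M summable_on UNIV"
    by (simp add: M_def case_prod_unfold)
  moreover have "norm (cont_term i p) \<le> M i" if "p \<in> K" for i p
  proof -
    obtain l l' where i: "i = (l, l')" by (cases i)
    obtain a b where p: "p = (a, b)" by (cases p)
    have ab: "a \<in> fst ` K" "b \<in> snd ` K" "a + b \<in> (\<lambda>p. fst p + snd p) ` K"
      using that p by force+
    have "norm (neg_binom a l) \<le> neg_binom R l"
      using R(2) ab(1) by (intro norm_neg_binom_le) auto
    moreover have "norm (reg_coeff b l') \<le> \<bar>C1\<bar> * (neg_binom R l' * q ^ l')"
      using order_trans[OF C1[OF ab(2), of l'] mult_right_mono[OF abs_ge_self]] binom_pos[of l'] q_pos by simp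
    moreover have "norm (q_geom (a + b - 2 + of_nat (l + l'))) \<le> \<bar>C2\<bar> * q ^ (l + l')"
      using order_trans[OF C2[OF ab(3), of "l + l'"] mult_right_mono[OF abs_ge_self]] q_pos by simp
    ultimately have "norm (cont_term i p) \<le> neg_binom R l * (\<bar>C1\<bar> * (neg_binom R l' * q ^ l')) * (\<bar>C2\<bar> * q ^ (l + l'))"
      unfolding i p cont_term_def prod.case norm_mult using binom_pos q_pos
      by (intro mult_mono) (auto simp: less_imp_le)
    \<comment> \<open>The surplus power \<open>q ^ l'\<close> is at most 1 and is dropped
      next.\<close>
    also have "\<dots> = M i * q ^ l'"
      by (simp add: M_def i power_add abs_mult mult_ac)
    also have "\<dots> \<le> M i"
      using power_nonneg_le_1[of l'] binom_pos q_pos by (intro mult_left_le) (auto simp: M_def i less_imp_le)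
    finally show ?thesis .
  qed
  ultimately show ?thesis by blast
qed

lemma cont_sum_continuous: "continuous_on regular_pairs cont_sum"
  unfolding cont_sum_def[abs_def]
  using open_regular_pairs cont_term_continuous cont_term_bound by (rule continuous_on_infsum_compact)

lemma cont_sum_holomorphic_fst: "(\<lambda>a. cont_sum (a, b)) holomorphic_on {a. (a, b) \<in> regular_pairs}"
  unfolding cont_sum_def
proof (rule holomorphic_on_infsum_compact)
  have "open ((\<lambda>a. (a, b)) -` regular_pairs)"
    by (intro open_vimage open_regular_pairs continuous_intros)
  then show "open {a. (a, b) \<in> regular_pairs}"
    by (simp add: vimage_def)
  show "(\<lambda>a. cont_term i (a, b)) holomorphic_on {a. (a, b) \<in> regular_pairs}" for i
    unfolding cont_term_def case_prod_unfold neg_binom_def fst_conv snd_conv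
    by (intro holomorphic_intros sum_regular_q_powr) (auto simp: regular_pairs_def)
  fix K assume K: "compact K" "K \<subseteq> {a. (a, b) \<in> regular_pairs}"
  have "compact (K \<times> {b})" "K \<times> {b} \<subseteq> regular_pairs"
    using K by (auto intro: compact_Times)
  from cont_term_bound[OF this]
  show "\<exists>M. M summable_on UNIV \<and> (\<forall>i\<in>UNIV. \<forall>x\<in>K. norm (cont_term i (x, b)) \<le> M i)"
    by auto
qed

lemma cont_sum_holomorphic_snd: "(\<lambda>b. cont_sum (a, b)) holomorphic_on {b. (a, b) \<in> regular_pairs}"
  unfolding cont_sum_def
proof (rule holomorphic_on_infsum_compact)
  have "open ((\<lambda>b. (a, b)) -` regular_pairs)"
    by (intro open_vimage open_regular_pairs continuous_intros)
  then show "open {b. (a, b) \<in> regular_pairs}"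
    by (simp add: vimage_def)
  show "(\<lambda>b. cont_term i (a, b)) holomorphic_on {b. (a, b) \<in> regular_pairs}" for i
    unfolding cont_term_def case_prod_unfold neg_binom_def fst_conv snd_conv
    by (intro holomorphic_intros sum_regular_q_powr holomorphic_on_subset[OF reg_coeff_holomorphic])
       (auto simp: regular_pairs_def)
  fix K assume K: "compact K" "K \<subseteq> {b. (a, b) \<in> regular_pairs}"
  have "compact ({a} \<times> K)" "{a} \<times> K \<subseteq> regular_pairs"
    using K by (auto intro: compact_Times)
  from cont_term_bound[OF this]
  show "\<exists>M. M summable_on UNIV \<and> (\<forall>i\<in>UNIV. \<forall>x\<in>K. norm (cont_term i (a, x)) \<le> M i)"
    by auto
qed

section \<open>Agreement with the series in the domain of convergence\<close>

lemma q_summand_binomial: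
  assumes "m > 0"
  shows "q_summand q a m = of_real (1 - q) powr a * ((of_real q powr (a - 1)) ^ m * of_real (1 - q ^ m) powr (- a))"
proof -
  have "of_real (q_int q m) powr a = (of_real (1 - q ^ m) powr a / of_real (1 - q) powr a :: complex)"
    using q_less_1 power_less_1[OF assms] q_int_pos[OF assms]
    by (simp add: powr_def Ln_of_real exp_diff[symmetric] right_diff_distrib[symmetric] del: of_real_diff)
       (simp add: q_int_def ln_div)
  then show ?thesis
    unfolding q_summand_def q_powr_mult_nat by (simp add: powr_minus divide_inverse)
qed

text \<open>The fourfold series over binomial indices \<open>(l, l')\<close> and summation indices
  \<open>(i, j)\<close> converges absolutely. Summing over \<open>(i, j)\<close> first gives
  \<open>cont_term\<close>; summing over \<open>(l, l')\<close> first gives back the summands of the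
  double series.\<close>

lemma cont_sum_eq_series:
  assumes b: "Re b > 1" and ab: "Re (a + b) > 2"
  shows "zeta_q_series q [a, b] = of_real (1 - q) powr (a + b) * cont_sum (a, b)"
proof -
  \<comment> \<open>Ratios of the two geometric series: the larger index is
    \<open>Suc i + Suc j\<close>, so \<open>z\<close> collects the exponents of both variables and
    \<open>y\<close> only that of the second.\<close>
  define z where "z = (\<lambda>l l'. complex_of_real q powr (a + b - 2 + of_nat (l + l')))"
  define y where "y = (\<lambda>l'. complex_of_real q powr (b - 1 + of_nat l'))"
  define f where "f = (\<lambda>(l, l') (i, j). neg_binom a l * neg_binom b l' * (z l l' ^ Suc i * y l' ^ Suc j))"
  define u v where "u = q powr (Re (a + b) - 2)" and "v = q powr (Re b - 1)"
  have uv: "0 \<le> u" "u < 1" "0 \<le> v" "v < 1"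
    unfolding u_def v_def using assms q_pos q_less_1 by (auto simp: powr01_less_one)
  have norm_z: "norm (z l l') = u * q ^ l * q ^ l'" for l l'
    using q_pos unfolding z_def q_powr_add_nat norm_mult norm_q_powr by (simp add: u_def power_add norm_mult norm_power)
  have norm_y: "norm (y l') = v * q ^ l'" for l'
    using q_pos unfolding y_def q_powr_add_nat norm_mult norm_q_powr by (simp add: v_def norm_power)
  have z_less: "norm (z l l') < 1" for l l'
  proof -
    have "u * q ^ l * q ^ l' \<le> u"
      using uv power_nonneg_le_1 by (simp add: mult.assoc mult_left_le mult_le_one)
    then show ?thesis
      using norm_z uv by simp
  qed
  have y_less: "norm (y l') < 1" for l'
  proof -
    have "v * q ^ l' \<le> v"
      using uv power_nonneg_le_1 by (simp add: mult_left_le)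
    then show ?thesis
      using norm_y uv by simp
  qed

  have inner: "infsum (f i) (UNIV \<times> UNIV) = cont_term i (a, b)" for i
  proof -
    obtain l l' where i: "i = (l, l')" by (cases i)
    have "((\<lambda>(i, j). z l l' ^ Suc i * y l' ^ Suc j) has_sum z l l' / (1 - z l l') * (y l' / (1 - y l'))) (UNIV \<times> UNIV)"
      by (intro has_sum_Times_mult has_sum_geometric_Suc z_less y_less)
    from has_sum_cmult_right[OF this, of "neg_binom a l * neg_binom b l'"]
    have "(f i has_sum neg_binom a l * neg_binom b l' * (z l l' / (1 - z l l') * (y l' / (1 - y l')))) (UNIV \<times> UNIV)"
      by (simp add: f_def i case_prod_unfold)
    moreover have "y l' \<noteq> 1"
      using y_less[of l'] by auto
    then have "reg_coeff b l' = neg_binom b l' * (y l' / (1 - y l'))"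
      by (subst reg_coeff_eq) (simp_all add: y_def q_geom_def)
    ultimately show ?thesis
      by (intro infsumI) (simp add: i cont_term_def q_geom_def z_def mult_ac)
  qed

  have outer: "infsum (\<lambda>i. f i (j, k)) (UNIV \<times> UNIV) =
      (of_real q powr (a - 1)) ^ Suc j * of_real (1 - q ^ Suc j) powr (- a) *
      ((of_real q powr (b - 1)) ^ (Suc j + Suc k) * of_real (1 - q ^ (Suc j + Suc k)) powr (- b))" for j k
  proof -
    have split: "z l l' ^ Suc j * y l' ^ Suc k =
        (of_real q powr (a - 1)) ^ Suc j * (of_real q powr (b - 1)) ^ (Suc j + Suc k) *
        (of_real ((q ^ Suc j) ^ l) * of_real ((q ^ (Suc j + Suc k)) ^ l'))" for l l'
    proof -
      have "z l l' = of_real q powr (a - 1) * of_real q powr (b - 1) * of_real q ^ l * of_real q ^ l'"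
        unfolding z_def q_powr_add_nat by (simp add: power_add flip: powr_add)
      moreover have "y l' = of_real q powr (b - 1) * of_real q ^ l'"
        unfolding y_def q_powr_add_nat by simp
      moreover have "(A * B * P * R) ^ Suc j * (B * R) ^ Suc k =
          A ^ Suc j * B ^ (Suc j + Suc k) * (P ^ Suc j * R ^ (Suc j + Suc k))" for A B P R :: complex
        by (simp only: power_mult_distrib power_add mult_ac)
      moreover have "(of_real q ^ n) ^ Suc j = (of_real ((q ^ Suc j) ^ n) :: complex)"
        "(of_real q ^ n) ^ (Suc j + Suc k) = (of_real ((q ^ (Suc j + Suc k)) ^ n) :: complex)" for n
        by (simp_all only: of_real_power[symmetric] power_mult[symmetric] mult.commute)
      ultimately show ?thesis
        by (simp only:)
    qed
    have "((\<lambda>(l, l'). neg_binom a l * of_real ((q ^ Suc j) ^ l) * (neg_binom b l' * of_real ((q ^ (Suc j + Suc k)) ^ l'))) has_sum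
        of_real (1 - q ^ Suc j) powr (- a) * of_real (1 - q ^ (Suc j + Suc k)) powr (- b)) (UNIV \<times> UNIV)"
      by (intro has_sum_Times_mult neg_binom_has_sum power_nonneg_le_1 power_less_1) simp_all
    from has_sum_cmult_right[OF this, of "(of_real q powr (a - 1)) ^ Suc j * (of_real q powr (b - 1)) ^ (Suc j + Suc k)"]
    have "((\<lambda>i. f i (j, k)) has_sum (of_real q powr (a - 1)) ^ Suc j * (of_real q powr (b - 1)) ^ (Suc j + Suc k) *
        (of_real (1 - q ^ Suc j) powr (- a) * of_real (1 - q ^ (Suc j + Suc k)) powr (- b))) (UNIV \<times> UNIV)"
      unfolding f_def case_prod_unfold fst_conv snd_conv split by (simp only: mult_ac)
    then show ?thesis
      by (intro infsumI) (simp only: mult_ac)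
  qed

  define B where "B = (\<lambda>((l, l'), (i, j)). (neg_binom (norm a) l * q ^ l) * (neg_binom (norm b) l' * q ^ l') *
    (u ^ Suc i * v ^ Suc j))"
  have "B summable_on (UNIV \<times> UNIV) \<times> (UNIV \<times> UNIV)"
  proof -
    have "(\<lambda>i. u ^ Suc i) summable_on UNIV" "(\<lambda>i. v ^ Suc i) summable_on UNIV"
      using summable_on_cmult_right[OF summable_on_geometric[of u], of u]
        summable_on_cmult_right[OF summable_on_geometric[of v], of v] uv by simp_all
    then have geometric: "(\<lambda>(i, j). u ^ Suc i * v ^ Suc j) summable_on UNIV \<times> UNIV"
      using uv by (intro summable_on_Times_mult) auto
    have binomial: "(\<lambda>(l, l'). (neg_binom (norm a) l * q ^ l) * (neg_binom (norm b) l' * q ^ l')) summable_on UNIV \<times> UNIV"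
      using q_pos q_less_1 neg_binom_nonneg
      by (intro summable_on_Times_mult neg_binom_summable) auto
    have "(\<lambda>(x, y). (case x of (l, l') \<Rightarrow> (neg_binom (norm a) l * q ^ l) * (neg_binom (norm b) l' * q ^ l')) *
        (case y of (i, j) \<Rightarrow> u ^ Suc i * v ^ Suc j)) summable_on (UNIV \<times> UNIV) \<times> (UNIV \<times> UNIV)"
      by (rule summable_on_Times_mult[OF binomial geometric]) (use q_pos neg_binom_nonneg uv in auto)
    then show ?thesis
      by (simp add: B_def case_prod_unfold)
  qed
  moreover have "norm (case p of (x, y) \<Rightarrow> f x y) \<le> B p" for p
  proof -
    obtain l l' i j where p: "p = ((l, l'), (i, j))"
      by (metis surj_pair)
    \<comment> \<open>As \<open>Suc i \<ge> 1\<close>, one factor \<open>q ^ l * q ^ l'\<close>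
      survives beside \<open>u ^ Suc i\<close>; it makes the binomial sums converge, so for
      \<open>y\<close> the bound \<open>v ^ Suc j\<close> is enough.\<close>
    have "norm (z l l' ^ Suc i) \<le> u ^ Suc i * (q ^ l * q ^ l')"
    proof -
      have "(q ^ l * q ^ l') ^ Suc i \<le> q ^ l * q ^ l'"
        using power_nonneg_le_1 power_decreasing[of 1 "Suc i" "q ^ l * q ^ l'"] by (simp add: mult_le_one)
      then show ?thesis
        using uv by (simp only: norm_power norm_z mult.assoc power_mult_distrib[of u]) (intro mult_left_mono, auto)
    qed
    moreover have "norm (y l' ^ Suc j) \<le> v ^ Suc j"
      unfolding norm_power norm_y using uv power_nonneg_le_1[of l'] by (intro power_mono mult_left_le) auto
    ultimately have "norm (f (l, l') (i, j)) \<le> neg_binom (norm a) l * neg_binom (norm b) l' *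
        (u ^ Suc i * (q ^ l * q ^ l') * v ^ Suc j)"
      unfolding f_def prod.case norm_mult using neg_binom_nonneg[of "norm a" l] neg_binom_nonneg[of "norm b" l'] uv q_pos
      by (intro mult_mono norm_neg_binom_le) auto
    then show ?thesis
      by (simp add: p B_def mult_ac)
  qed
  ultimately have "(\<lambda>p. norm (case p of (x, y) \<Rightarrow> f x y)) summable_on (UNIV \<times> UNIV) \<times> (UNIV \<times> UNIV)"
    by (intro Infinite_Sum.abs_summable_on_comparison_test'[where g = B])
  then have "(\<lambda>(x, y). f x y) summable_on (UNIV \<times> UNIV) \<times> (UNIV \<times> UNIV)"
    by (rule abs_summable_summable)
  then have swap: "infsum (\<lambda>x. infsum (f x) (UNIV \<times> UNIV)) (UNIV \<times> UNIV) =
      infsum (\<lambda>y. infsum (\<lambda>x. f x y) (UNIV \<times> UNIV)) (UNIV \<times> UNIV)"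
    by (rule infsum_swap_banach)
  have "zeta_q_series q [a, b] = infsum (\<lambda>p. of_real (1 - q) powr (a + b) * infsum (\<lambda>x. f x p) (UNIV \<times> UNIV)) (UNIV \<times> UNIV)"
    unfolding zeta_q_series_pair UNIV_Times_UNIV[symmetric]
  proof (rule infsum_cong)
    fix p :: "nat \<times> nat"
    obtain j k where p: "p = (j, k)" by (cases p)
    have "q_summand q a (Suc j) * q_summand q b (Suc j + Suc k) =
        (of_real (1 - q) powr a * of_real (1 - q) powr b) * infsum (\<lambda>x. f x (j, k)) (UNIV \<times> UNIV)"
      unfolding outer by (simp only: q_summand_binomial zero_less_Suc add_pos_pos mult_ac)
    then show "(case p of (i, j) \<Rightarrow> q_summand q a (Suc i) * q_summand q b (Suc i + Suc j)) =
        of_real (1 - q) powr (a + b) * infsum (\<lambda>x. f x p) (UNIV \<times> UNIV)"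
      by (simp only: p prod.case powr_add)
  qed
  also have "\<dots> = of_real (1 - q) powr (a + b) * infsum (\<lambda>x. infsum (f x) (UNIV \<times> UNIV)) (UNIV \<times> UNIV)"
    by (simp only: infsum_cmult_right' swap)
  also have "infsum (\<lambda>x. infsum (f x) (UNIV \<times> UNIV)) (UNIV \<times> UNIV) = cont_sum (a, b)"
    unfolding inner cont_sum_def by simp
  finally show ?thesis .
qed

section \<open>Identification of the continued zeta values\<close>

lemma zeta_q_conv_pair: "[a, b] \<in> zeta_q_conv 2 \<longleftrightarrow> Re b > 1 \<and> Re (a + b) > 2"
proof -
  have "{1..2} = {1, 2::nat}" by auto
  then show ?thesis
    by (auto simp: zeta_q_conv_def)
qed

text \<open>\<open>zeta_q\<close> is defined by choice, so a continuation has to be exhibited before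
  the chosen one is known to be one.\<close>

lemma continuation_exists: "\<exists>F. is_zeta_q_continuation q 2 F"
proof
  define F where "F = (\<lambda>ss. of_real (1 - q) powr (ss ! 0 + ss ! 1) * cont_sum (ss ! 0, ss ! 1))"
  define D where "D = {ss. length ss = 2} - zeta_q_sing q 2"
  have pair: "[a, b] \<in> D \<longleftrightarrow> (a, b) \<in> regular_pairs" for a b
    using pair_notin_sing[of a b] by (simp add: D_def regular_pairs_def)
  have upt: "[0..<2] = [0, 1::nat]"
    by (simp add: upt_rec)
  have nz: "complex_of_real (1 - q) \<noteq> 0"
    using q_less_1 by simp
  show "is_zeta_q_continuation q 2 F"
    unfolding is_zeta_q_continuation_def holomorphic_in_vars_def D_def[symmetric]
  proof (intro conjI ballI allI impI)
    have "continuous_on {v. map v [0..<2] \<in> D} (\<lambda>v. cont_sum (v 0, v 1))"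
      by (rule continuous_on_compose2[OF cont_sum_continuous])
         (auto simp: upt pair intro!: continuous_intros continuous_on_subset[OF continuous_on_product_coordinates])
    moreover have "continuous_on {v :: nat \<Rightarrow> complex. map v [0..<2] \<in> D} (\<lambda>v. of_real (1 - q) powr (v 0 + v 1))"
      using nz q_less_1 by (auto intro!: continuous_intros continuous_on_subset[OF continuous_on_product_coordinates])
    ultimately show "continuous_on {v. map v [0..<2] \<in> D} (\<lambda>v. F (map v [0..<2]))"
      unfolding F_def upt by (simp add: continuous_on_mult)
  next
    fix ss j
    assume "ss \<in> D" "j < (2::nat)"
    then obtain a b where ss: "ss = [a, b]"
      by (auto simp: D_def numeral_2_eq_2 length_Suc_conv)
    from \<open>j < 2\<close> consider "j = 0" | "j = 1" by linarith
    then show "(\<lambda>z. F (ss[j := z])) holomorphic_on {z. ss[j := z] \<in> D}"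
    proof cases
      case 1
      have "(\<lambda>z. of_real (1 - q) powr (z + b) * cont_sum (z, b)) holomorphic_on {z. (z, b) \<in> regular_pairs}"
        by (intro holomorphic_intros cont_sum_holomorphic_fst)
      then show ?thesis
        by (simp add: 1 ss F_def pair)
    next
      case 2
      have "(\<lambda>z. of_real (1 - q) powr (a + z) * cont_sum (a, z)) holomorphic_on {z. (a, z) \<in> regular_pairs}"
        by (intro holomorphic_intros cont_sum_holomorphic_snd)
      then show ?thesis
        by (simp add: 2 ss F_def pair)
    qed
  next
    fix ss assume ss: "ss \<in> zeta_q_conv 2"
    then obtain a b where "ss = [a, b]"
      by (auto simp: zeta_q_conv_def numeral_2_eq_2 length_Suc_conv)
    then show "F ss = zeta_q_series q ss"
      using ss cont_sum_eq_series[of b a] by (simp add: zeta_q_conv_pair F_def)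
  qed
qed

text \<open>Singular values of \<open>a + b\<close> have an integer real part of at most 2, and
  \<open>Re (a + b) > 1\<close> leaves only 2.\<close>

lemma regular_pair_of_Re:
  assumes "Re b > 1" "Re (a + b) > 1" "a + b \<notin> {2 + of_int m * q_period q | m :: int. True}"
  shows "[a, b] \<in> {ss. length ss = 2} - zeta_q_sing q 2"
proof -
  have "b \<in> last_regular"
    using assms(1) by (auto simp: last_regular_def)
  moreover have "a + b \<in> sum_regular"
  proof (rule ccontr)
    assume "a + b \<notin> sum_regular"
    then obtain k m :: int where km: "k \<le> 2" "a + b = of_int k + of_int m * q_period q"
      by (auto simp: sum_regular_def)
    then have "Re (a + b) = of_int k"
      by simp
    then have "k = 2"
      using km(1) assms(2) by simp
    then show False
      using km(2) assms(3) by auto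
  qed
  ultimately show ?thesis
    using pair_notin_sing by simp
qed

text \<open>Identity theorem: both sides are holomorphic on the half-plane without the excluded
  points and agree for \<open>Re s > 2\<close>, where both double series converge. The argument
  holds for any continuation, hence for the chosen one.\<close>

lemma zeta_q_diff_eq:
  assumes s: "Re s > 1" "s \<notin> {2 + of_int m * q_period q | m :: int. True}"
  shows "zeta_q q [s - of_nat n - 2, of_nat n + 2] - zeta_q q [- of_nat n, s + of_nat n] = zeta_diff n s"
proof -
  define F where "F = (SOME F. is_zeta_q_continuation q 2 F)"
  have F: "is_zeta_q_continuation q 2 F"
    unfolding F_def using continuation_exists by (rule someI_ex)
  \<comment> \<open>In the domain of convergence \<open>zeta_q\<close> is the series, with which
    \<open>F\<close> agrees.\<close>
  have zeta: "zeta_q q [a, b] = F [a, b]" for a b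
    using F by (auto simp: zeta_q_def is_zeta_q_continuation_def F_def numeral_2_eq_2)
  have series: "F [a, b] = zeta_q_series q [a, b]" if "Re b > 1" "Re (a + b) > 2" for a b
    using F that by (simp add: is_zeta_q_continuation_def zeta_q_conv_pair)
  define D where "D = {ss. length ss = 2} - zeta_q_sing q 2"
  define P where "P = {2 + of_int m * q_period q | m :: int. True}"
  define U where "U = {s. Re s > 1} - P"
  have holo: "(\<lambda>z. F (ss[j := z])) holomorphic_on {z. ss[j := z] \<in> D}" if "ss \<in> D" "j < 2" for ss j
    using F that by (simp add: is_zeta_q_continuation_def holomorphic_in_vars_def D_def)
  have upper_D: "[t - of_nat n - 2, of_nat n + 2] \<in> D" and lower_D: "[- of_nat n, t + of_nat n] \<in> D" if "t \<in> U" for t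
    unfolding D_def using that by (intro regular_pair_of_Re; simp add: U_def P_def)+
  \<comment> \<open>Removing a closed countable set keeps the half-plane open and connected.\<close>
  have "countable P"
    unfolding P_def by (rule countable_subset[of _ "range (\<lambda>m::int. 2 + of_int m * q_period q)"]) auto
  moreover have "closed P"
    unfolding P_def by (rule closed_lattice_subset) (auto intro: exI[of _ "2::int"])
  ultimately have U: "open U" "connected U"
    unfolding U_def using connected_open_diff_countable[of "{s. Re s > 1}" P]
    by (auto simp: open_halfspace_Re_gt convex_connected convex_halfspace_Re_gt)
  have sU: "s \<in> U"
    using s by (simp add: U_def P_def)
  \<comment> \<open>In each of the two zeta values \<open>t\<close> enters a single coordinate, so
    separate holomorphy of \<open>F\<close> suffices.\<close>
  have "(\<lambda>t. F [t - of_nat n - 2, of_nat n + 2]) holomorphic_on U"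
  proof -
    have "(\<lambda>z. F [z, of_nat n + 2]) holomorphic_on {z. [z, of_nat n + 2] \<in> D}"
      using holo[OF upper_D[OF sU], of 0] by simp
    then show ?thesis
      by (rule holomorphic_on_compose_gen[unfolded o_def, rotated]) (auto intro!: holomorphic_intros upper_D)
  qed
  moreover have "(\<lambda>t. F [- of_nat n, t + of_nat n]) holomorphic_on U"
  proof -
    have "(\<lambda>z. F [- of_nat n, z]) holomorphic_on {z. [- of_nat n, z] \<in> D}"
      using holo[OF lower_D[OF sU], of 1] by simp
    then show ?thesis
      by (rule holomorphic_on_compose_gen[unfolded o_def, rotated]) (auto intro!: holomorphic_intros lower_D)
  qed
  ultimately have lhs: "(\<lambda>t. F [t - of_nat n - 2, of_nat n + 2] - F [- of_nat n, t + of_nat n]) holomorphic_on U"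
    by (rule holomorphic_on_diff)
  have rhs: "zeta_diff n holomorphic_on U"
    using zeta_diff_holomorphic by (rule holomorphic_on_subset) (auto simp: U_def)
  have "F [s - of_nat n - 2, of_nat n + 2] - F [- of_nat n, s + of_nat n] = zeta_diff n s"
  proof (rule analytic_continuation_open[OF _ U(1) _ U(2) _ lhs rhs _ sU])
    show "open {t. Re t > 2}"
      by (rule open_halfspace_Re_gt)
    have "(3::complex) \<in> {t. Re t > 2}" by simp
    then show "{t. Re t > 2} \<noteq> {}" by blast
    show "{t. Re t > 2} \<subseteq> U"
      by (auto simp: U_def P_def)
    show "F [t - of_nat n - 2, of_nat n + 2] - F [- of_nat n, t + of_nat n] = zeta_diff n t" if "t \<in> {t. Re t > 2}" for t
      using that zeta_q_series_diff[of t n] by (simp add: series)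
  qed
  then show ?thesis
    by (simp add: zeta)
qed

end

theorem theorem3:
  fixes q :: real and s :: complex
  assumes "0 < q" and "q < 1"
    and "Re s > 1"
    and "s \<notin> {2 + of_int m * q_period q | m :: int. True}"
  shows "(\<lambda>n. zeta_q q [s - of_nat n - 2, of_nat n + 2] - zeta_q q [- of_nat n, s + of_nat n])
           sums zeta_q q [s]"
proof -
  interpret q_base q
    using assms by unfold_locales
  have "[s] \<in> zeta_q_conv 1"
    using assms by (simp add: zeta_q_conv_def)
  then have "zeta_q q [s] = zeta_q_series q [s]"
    by (simp add: zeta_q_def)
  then show ?thesis
    using zeta_diff_sums[OF assms(3)] zeta_q_diff_eq[OF assms(3,4)] by simp
qed

end
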